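(* Let $X=a(x,y)\frac{\partial}{\partial x}+b(x,y)\frac{\partial}{\partial y}$ be an algebraically integrable complex planar polynomial vector field such that $X\neq c\,\frac{\partial}{\partial y}$ and $X\neq c\,\frac{\partial}{\partial x}$ for all $c\in\mathbb{C}\setminus\{0\}$. Let $X'=b(y,x)\frac{\partial}{\partial x}+a(y,x)\frac{\partial}{\partial y}$ be the vector field obtained from $X$ by swapping the variables. Let $\delta_1=\delta_1(X)$ and $\delta_1'=\delta_1(X')$ be the nonnegative integers defined in the context, and let $d_x^0$ (respectively, $d_y^0$) be the degree of $g(x,0)$ (respectively, $g(0,y)$), where $g$ is the generic algebraic invariant curve of $X$ associated to a primitive rational first integral of $X$. If $\delta_1=0$ (respectively, $\delta_1'=0$), then the degree of a primitive rational first integral of $X$ is bounded from above by $(1+\delta_1')d_x^0+d_y^0$ (respectively, $(1+\delta_1)d_y^0+d_x^0$).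
   Context: A complex planar polynomial vector field is $X=a(x,y)\frac{\partial}{\partial x}+b(x,y)\frac{\partial}{\partial y}$ with $a,b\in\mathbb{C}[x,y]$ coprime; it is also given by the $1$-form $\omega_X=b\,dx-a\,dy$. A rational first integral of $X$ is $f\in\mathbb{C}(x,y)\setminus\mathbb{C}$ with $X(f)=a f_x+b f_y=0$; $X$ is algebraically integrable if one exists. The degree of a reduced rational function $f_1/f_2$ is $\max(\deg f_1,\deg f_2)$. A rational first integral $f=f_1/f_2$ is primitive if it is reduced ($f_1,f_2$ coprime) and noncomposite (not of the form $u\circ h$ with $h\in\mathbb{C}(x,y)\setminus\mathbb{C}$, $u\in\mathbb{C}(t)$, $\deg u\ge 2$); an algebraically integrable $X$ always has one. The generic algebraic invariant curve of $X$ associated to a primitive $f=f_1/f_2$ is $g(x,y)=\alpha f_1(x,y)+\beta f_2(x,y)\in\mathbb{C}(\alpha,\beta)[x,y]$, with $\alpha,\beta$ independent variables. Hirzebruch surface. For an integer $\delta\ge 0$, $\mathbb{F}_\delta$ is the quotient of $(\mathbb{C}^2\setminus\{0\})\times(\mathbb{C}^2\setminus\{0\})$, with coordinates $(X_0,X_1;Y_0,Y_1)$, by the action of $(\mathbb{C}^* )^2$ given by $(\lambda,\mu)\cdot(X_0,X_1;Y_0,Y_1)=(\lambda X_0,\lambda X_1;\mu Y_0,\lambda^{-\delta}\mu Y_1)$. The open sets $U_{ij}=\{X_i\neq 0,\ Y_j\neq 0\}$ cover $\mathbb{F}_\delta$ and are isomorphic to $\mathbb{C}^2$ (normalize $X_i=1$,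 $Y_j=1$). $\mathbb{C}^2$ is identified with $U_{00}$ by $x=X_1/X_0$, $y=X_0^\delta Y_1/Y_0$. In $U_{10}$, with coordinates $(s,t)=(X_0/X_1,\,X_1^\delta Y_1/Y_0)$, one has $x=1/s$, $y=s^\delta t$. The extension $\mathcal{F}_X^\delta$ of $X$ to $\mathbb{F}_\delta$ is the singular algebraic foliation with isolated singularities on $\mathbb{F}_\delta$ whose restriction to $U_{00}=\mathbb{C}^2$ is the foliation defined by $\omega_X$: in each chart $U_{ij}$ it is given by the polynomial $1$-form with coprime coefficients proportional (by a rational function) to the pull-back of $\omega_X$ under the change of coordinates. Dicritical singularities. Let $\mathcal{G}$ be a foliation with isolated singularities on a smooth surface, given near a point $p$, in local coordinates $(x,y)$ centred at $p$, by $\omega=P\,dx+Q\,dy$ ($P,Q$ without common factor). Let $\omega_m=p_m\,dx+q_m\,dy$ be the first nonvanishing jet of $\omega$ ($p_m,q_m$ homogeneous of degree $m$). Then $p$ is a singularity iff $m\ge 1$. A singularity $p$ is terminal dicritical if $x p_m+y q_m$ is the zero polynomial. It is simple if $m=1$ and the matrix $\begin{pmatrix}\partial q_1/\partial x&\partial q_1/\partial y\\-\partial p_1/\partial x&-\partial p_1/\partial y\end{pmatrix}$ has eigenvalues $\lambda_1,\lambda_2$ such that either $\lambda_1\lambda_2\ne 0$ and $\lambda_1/\lambda_2$ is not a positive rational number, or $\lambda_1\lambda_2=0$ and $\lambda_1^2+\lambda_2^2\neq 0$. Nonsimple singularities are called ordinary. The strict transform of $\mathcal{G}$ under the blowup at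 $p$ is given by the pull-back of $\omega$ divided by the largest possible power of a local equation of the exceptional divisor. After finitely many blowups at ordinary singularities of $\mathcal{G}$ and of its successive strict transforms one reaches a foliation without ordinary singularities; the set of blowup centres is the singular configuration $\mathcal{C}_{\mathcal{G}}$. A point $q$ is infinitely near $p$ if $q=p$ or $q$ lies on an exceptional divisor created by successively blowing up $p$ and points over $p$. An ordinary singularity $p\in\mathcal{C}_{\mathcal{G}}$ is a dicritical singularity of $\mathcal{G}$ if there is $q\in\mathcal{C}_{\mathcal{G}}$ infinitely near $p$ (possibly $q=p$) which is a terminal dicritical singularity of the strict transform of $\mathcal{G}$ on the surface containing $q$. The integer $\delta_1(X)$. For $X$ algebraically integrable with $X\ne c\frac{\partial}{\partial y}$ for all $c\in\mathbb{C}\setminus\{0\}$, $\delta_1(X)$ is the minimum nonnegative integer $\delta$ such that the point $(0,1;1,0)\in\mathbb{F}_\delta$ is not a dicritical singularity of $\mathcal{F}_X^\delta$ (it exists; moreover for all $\delta>\delta_1(X)$ the point $(0,1;0,1)$ is the unique dicritical singularity of $\mathcal{F}_X^\delta$ on $X_0=0$). *)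

theory Defs
  imports
    "HOL-Computational_Algebra.Computational_Algebra"
    "Jordan_Normal_Form.Char_Poly"
begin

section \<open>Bivariate polynomials and rational functions\<close>

text \<open>
  The ring of polynomials in \<open>x\<close> and \<open>y\<close> over \<open>K\<close> is \<open>K[x][y]\<close>: the outer polynomial variable
  is \<open>y\<close>, the coefficients are polynomials in \<open>x\<close>. Its field of fractions is the field \<open>K(x,y)\<close>.
\<close>

type_synonym bipoly = "complex poly poly"
type_synonym birat = "complex poly poly fract"

definition cst :: "'a::comm_ring_1 \<Rightarrow> 'a poly poly" where
  "cst c = [:[:c:]:]"

definition var_x :: "'a::comm_ring_1 poly poly" where
  "var_x = [:[:0, 1:]:]"

definition var_y :: "'a::comm_ring_1 poly poly" where
  "var_y = [:0, 1:]"

definition rat :: "bipoly \<Rightarrow> birat" where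
  "rat p = Fraction_Field.Fract p 1"

definition rcst :: "complex \<Rightarrow> birat" where
  "rcst c = rat (cst c)"

text \<open>\<open>p(u,v)\<close> for \<open>u\<close>, \<open>v\<close> in a ring into which the coefficient ring is embedded by \<open>emb\<close>.\<close>

definition bieval :: "('a::zero \<Rightarrow> 'b::comm_ring_1) \<Rightarrow> 'a poly poly \<Rightarrow> 'b \<Rightarrow> 'b \<Rightarrow> 'b" where
  "bieval emb p u v = poly (map_poly (\<lambda>q. poly (map_poly emb q) u) p) v"

definition swap_vars :: "bipoly \<Rightarrow> bipoly" where
  "swap_vars p = bieval cst p var_y var_x"

definition total_degree :: "'a::zero poly poly \<Rightarrow> nat" where
  "total_degree p = Max ((\<lambda>j. j + degree (coeff p j)) ` {..degree p})"

definition dx :: "bipoly \<Rightarrow> bipoly" where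
  "dx p = map_poly pderiv p"

definition dy :: "bipoly \<Rightarrow> bipoly" where
  "dy p = pderiv p"

lemma dx_mult: "dx (p * q) = dx p * q + p * dx q"
proof (rule poly_eqI)
  fix n
  have "pderiv (coeff p i * coeff q (n - i)) =
          pderiv (coeff p i) * coeff q (n - i) + coeff p i * pderiv (coeff q (n - i))" for i
    by (simp add: pderiv_mult mult.commute)
  then show "coeff (dx (p * q)) n = coeff (dx p * q + p * dx q) n"
    by (simp add: dx_def coeff_map_poly coeff_mult pderiv_sum sum.distrib)
qed

lemma dy_mult: "dy (p * q) = dy p * q + p * dy q"
  by (simp add: dy_def pderiv_mult algebra_simps)

lemma quotient_rule_respects:
  fixes D :: "'a::idom \<Rightarrow> 'a"
  assumes D: "\<And>p q. D (p * q) = D p * q + p * D q"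
    and "q \<noteq> 0" "q' \<noteq> 0" and eq: "p * q' = p' * q"
  shows "(D p * q - p * D q) * (q' * q') = (D p' * q' - p' * D q') * (q * q)"
proof -
  have "D p * q' + p * D q' = D p' * q + p' * D q"
    using arg_cong[OF eq, of D] by (simp add: D)
  moreover have "(D p * q - p * D q) * (q' * q') - (D p' * q' - p' * D q') * (q * q) =
      (D p * q' + p * D q' - (D p' * q + p' * D q)) * (q * q') +
      (p' * q - p * q') * (q * D q' + q' * D q)"
    by (simp add: algebra_simps)
  ultimately show ?thesis
    using eq by simp
qed

text \<open>The quotient rule; the value does not depend on the chosen representation \<open>p / q\<close>.\<close>

definition fract_derivation :: "(bipoly \<Rightarrow> bipoly) \<Rightarrow> birat \<Rightarrow> birat" where
  "fract_derivation D f =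
     (THE g. \<exists>p q. q \<noteq> 0 \<and> f = Fraction_Field.Fract p q \<and>
        g = Fraction_Field.Fract (D p * q - p * D q) (q * q))"

lemma fract_derivation_Fract:
  assumes D: "\<And>p q. D (p * q) = D p * q + p * D q" and q: "q \<noteq> 0"
  shows "fract_derivation D (Fraction_Field.Fract p q) =
           Fraction_Field.Fract (D p * q - p * D q) (q * q)"
  unfolding fract_derivation_def
proof (rule the_equality)
  show "\<exists>p' q'. q' \<noteq> 0 \<and> Fraction_Field.Fract p q = Fraction_Field.Fract p' q' \<and>
          Fraction_Field.Fract (D p * q - p * D q) (q * q) =
          Fraction_Field.Fract (D p' * q' - p' * D q') (q' * q')"
    using q by blast
next
  fix g
  assume "\<exists>p' q'. q' \<noteq> 0 \<and> Fraction_Field.Fract p q = Fraction_Field.Fract p' q' \<and>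
            g = Fraction_Field.Fract (D p' * q' - p' * D q') (q' * q')"
  then obtain p' q' where q': "q' \<noteq> 0"
    and eq: "Fraction_Field.Fract p q = Fraction_Field.Fract p' q'"
    and g: "g = Fraction_Field.Fract (D p' * q' - p' * D q') (q' * q')"
    by blast
  from eq have "p' * q = p * q'"
    using q q' by (simp add: eq_fract)
  then have "(D p' * q' - p' * D q') * (q * q) = (D p * q - p * D q) * (q' * q')"
    by (intro quotient_rule_respects D q q')
  then show "g = Fraction_Field.Fract (D p * q - p * D q) (q * q)"
    using q q' by (simp add: g eq_fract)
qed

definition rdx :: "birat \<Rightarrow> birat" where
  "rdx = fract_derivation dx"

definition rdy :: "birat \<Rightarrow> birat" where
  "rdy = fract_derivation dy"

lemma rdx_Fract:
  "q \<noteq> 0 \<Longrightarrow> rdx (Fraction_Field.Fract p q) = Fraction_Field.Fract (dx p * q - p * dx q) (q * q)"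
  unfolding rdx_def by (rule fract_derivation_Fract[OF dx_mult])

lemma rdy_Fract:
  "q \<noteq> 0 \<Longrightarrow> rdy (Fraction_Field.Fract p q) = Fraction_Field.Fract (dy p * q - p * dy q) (q * q)"
  unfolding rdy_def by (rule fract_derivation_Fract[OF dy_mult])

section \<open>Rational first integrals\<close>

text \<open>
  The vector field \<open>a \<partial>/\<partial>x + b \<partial>/\<partial>y\<close> is given by its two components \<open>a\<close>, \<open>b\<close>.
\<close>

definition rational_first_integral :: "bipoly \<Rightarrow> bipoly \<Rightarrow> birat \<Rightarrow> bool" where
  "rational_first_integral a b f \<longleftrightarrow>
     f \<notin> range rcst \<and> rat a * rdx f + rat b * rdy f = 0"

definition algebraically_integrable :: "bipoly \<Rightarrow> bipoly \<Rightarrow> bool" where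
  "algebraically_integrable a b \<longleftrightarrow> (\<exists>f. rational_first_integral a b f)"

text \<open>
  Here \<open>u = u1 / u2\<close> is a reduced univariate rational function. Since \<open>h\<close> is not constant,
  \<open>u2(h)\<close> is nonzero.
\<close>

definition composite :: "birat \<Rightarrow> bool" where
  "composite f \<longleftrightarrow>
     (\<exists>h u1 u2. h \<notin> range rcst \<and> coprime u1 u2 \<and> u2 \<noteq> 0 \<and> max (degree u1) (degree u2) \<ge> 2 \<and>
        f = poly (map_poly rcst u1) h / poly (map_poly rcst u2) h)"

definition primitive_first_integral :: "bipoly \<Rightarrow> bipoly \<Rightarrow> bipoly \<Rightarrow> bipoly \<Rightarrow> bool" where
  "primitive_first_integral a b f1 f2 \<longleftrightarrow>
     coprime f1 f2 \<and> f2 \<noteq> 0 \<and>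
     rational_first_integral a b (Fraction_Field.Fract f1 f2) \<and>
     \<not> composite (Fraction_Field.Fract f1 f2)"

definition reduced_degree :: "bipoly \<Rightarrow> bipoly \<Rightarrow> nat" where
  "reduced_degree f1 f2 = max (total_degree f1) (total_degree f2)"

text \<open>
  The coefficient field of the generic curve is the field of rational functions in the two
  independent variables \<open>\<alpha>\<close>, \<open>\<beta>\<close>; it is again represented by \<^typ>\<open>birat\<close>, with \<open>\<alpha>\<close>, \<open>\<beta>\<close> in place of
  \<open>x\<close>, \<open>y\<close>.
\<close>

definition generic_curve :: "bipoly \<Rightarrow> bipoly \<Rightarrow> birat poly poly" where
  "generic_curve f1 f2 =
     cst (rat var_x) * map_poly (map_poly rcst) f1 + cst (rat var_y) * map_poly (map_poly rcst) f2"

text \<open>The degrees of \<open>g(x,0)\<close> and of \<open>g(0,y)\<close>.\<close>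

definition degree_x_axis :: "'a::comm_ring_1 poly poly \<Rightarrow> nat" where
  "degree_x_axis g = degree (poly g 0)"

definition degree_y_axis :: "'a::comm_ring_1 poly poly \<Rightarrow> nat" where
  "degree_y_axis g = degree (map_poly (\<lambda>c. poly c 0) g)"

section \<open>Singularities of foliations\<close>

text \<open>
  A pair \<open>(P, Q)\<close> stands for the 1-form \<open>P dx + Q dy\<close>; local notions refer to the origin.
\<close>

type_synonym form = "bipoly \<times> bipoly"

definition translate_form :: "complex \<times> complex \<Rightarrow> form \<Rightarrow> form" where
  "translate_form = (\<lambda>(u, v) (P, Q).
     (bieval cst P (var_x + cst u) (var_y + cst v), bieval cst Q (var_x + cst u) (var_y + cst v)))"

definition hom_part :: "nat \<Rightarrow> bipoly \<Rightarrow> bipoly" where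
  "hom_part m p = (\<Sum>j\<le>m. monom (monom (coeff (coeff p j) (m - j)) (m - j)) j)"

definition form_order :: "form \<Rightarrow> nat" where
  "form_order = (\<lambda>(P, Q). LEAST m. hom_part m P \<noteq> 0 \<or> hom_part m Q \<noteq> 0)"

definition first_jet :: "form \<Rightarrow> form" where
  "first_jet = (\<lambda>(P, Q). (hom_part (form_order (P, Q)) P, hom_part (form_order (P, Q)) Q))"

definition singular :: "form \<Rightarrow> bool" where
  "singular \<omega> \<longleftrightarrow> form_order \<omega> \<ge> 1"

definition terminal_dicritical :: "form \<Rightarrow> bool" where
  "terminal_dicritical \<omega> \<longleftrightarrow>
     singular \<omega> \<and> (case first_jet \<omega> of (p, q) \<Rightarrow> var_x * p + var_y * q = 0)"

definition at_origin :: "bipoly \<Rightarrow> complex" where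
  "at_origin p = poly (poly p 0) 0"

definition linear_part :: "form \<Rightarrow> complex mat" where
  "linear_part \<omega> = (case first_jet \<omega> of (p, q) \<Rightarrow>
     mat_of_rows_list 2
       [[  at_origin (dx q),   at_origin (dy q)],
        [- at_origin (dx p), - at_origin (dy p)]])"

definition simple_singularity :: "form \<Rightarrow> bool" where
  "simple_singularity \<omega> \<longleftrightarrow>
     form_order \<omega> = 1 \<and>
     (\<exists>l1 l2. char_poly (linear_part \<omega>) = [:- l1, 1:] * [:- l2, 1:] \<and>
        (l1 * l2 \<noteq> 0 \<and> \<not> (\<exists>r::rat. r > 0 \<and> l1 / l2 = of_rat r) \<or>
         l1 * l2 = 0 \<and> l1\<^sup>2 + l2\<^sup>2 \<noteq> 0))"

definition ordinary_singularity :: "form \<Rightarrow> bool" where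
  "ordinary_singularity \<omega> \<longleftrightarrow> singular \<omega> \<and> \<not> simple_singularity \<omega>"

section \<open>Blowups and dicritical singularities\<close>

definition pullback :: "bipoly \<Rightarrow> bipoly \<Rightarrow> form \<Rightarrow> form" where
  "pullback \<phi> \<psi> = (\<lambda>(P, Q).
     (bieval cst P \<phi> \<psi> * dx \<phi> + bieval cst Q \<phi> \<psi> * dx \<psi>,
      bieval cst P \<phi> \<psi> * dy \<phi> + bieval cst Q \<phi> \<psi> * dy \<psi>))"

text \<open>
  The points of the exceptional divisor of the blowup at the origin correspond to the tangent
  directions there. For each of them, \<open>blowup_chart\<close> gives the blowup map in coordinates \<open>(u,v)\<close>
  centred at that point, \<open>(u,v) \<mapsto> (u, u (v + c))\<close> or \<open>(u,v) \<mapsto> (u v, v)\<close>, followed by the local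
  equation (\<open>u\<close> or \<open>v\<close>) of the exceptional divisor.
\<close>

datatype direction = Slope complex | Vertical

fun blowup_chart :: "direction \<Rightarrow> bipoly \<times> bipoly \<times> bipoly" where
  "blowup_chart (Slope c) = (var_x, var_x * (var_y + cst c), var_x)"
| "blowup_chart Vertical = (var_x * var_y, var_y, var_y)"

definition strict_transform :: "form \<Rightarrow> direction \<Rightarrow> form \<Rightarrow> bool" where
  "strict_transform \<omega> d \<omega>' \<longleftrightarrow>
     (case blowup_chart d of (\<phi>, \<psi>, e) \<Rightarrow>
        \<exists>k. pullback \<phi> \<psi> \<omega> = (e ^ k * fst \<omega>', e ^ k * snd \<omega>') \<and>
            \<not> (e dvd fst \<omega>' \<and> e dvd snd \<omega>'))"

text \<open>
  The points of the singular configuration of \<open>\<omega>\<close> that are infinitely near the origin, each given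
  by the strict transform of \<open>\<omega>\<close> in coordinates centred at the point.
\<close>

inductive config_over :: "form \<Rightarrow> form \<Rightarrow> bool" for \<omega> where
  base: "ordinary_singularity \<omega> \<Longrightarrow> config_over \<omega> \<omega>"
| blowup: "config_over \<omega> \<eta> \<Longrightarrow> strict_transform \<eta> d \<eta>' \<Longrightarrow> ordinary_singularity \<eta>' \<Longrightarrow>
    config_over \<omega> \<eta>'"

definition dicritical :: "form \<Rightarrow> bool" where
  "dicritical \<omega> \<longleftrightarrow> (\<exists>\<eta>. config_over \<omega> \<eta> \<and> terminal_dicritical \<eta>)"

section \<open>Hirzebruch surfaces\<close>

text \<open>
  A point of the Hirzebruch surface is represented by homogeneous coordinates
  \<open>(X0, X1; Y0, Y1)\<close> with \<open>(X0, X1) \<noteq> (0, 0)\<close> and \<open>(Y0, Y1) \<noteq> (0, 0)\<close>. The chart of index \<open>(i, j)\<close> is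
  the set where \<open>Xi\<close> and \<open>Yj\<close> are nonzero; the booleans \<open>i\<close>, \<open>j\<close> stand for the index 1 when true and
  for 0 when false. The normalization \<open>Xi = 1\<close>, \<open>Yj = 1\<close> gives the coordinates of \<open>hirz_coords\<close>.
\<close>

type_synonym hirz_point = "complex \<times> complex \<times> complex \<times> complex"

definition hirz_action :: "nat \<Rightarrow> complex \<Rightarrow> complex \<Rightarrow> hirz_point \<Rightarrow> hirz_point" where
  "hirz_action \<delta> l m = (\<lambda>(X0, X1, Y0, Y1). (l * X0, l * X1, m * Y0, m * Y1 / l ^ \<delta>))"

definition in_hirz_chart :: "bool \<Rightarrow> bool \<Rightarrow> hirz_point \<Rightarrow> bool" where
  "in_hirz_chart i j = (\<lambda>(X0, X1, Y0, Y1).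
     (if i then X1 else X0) \<noteq> 0 \<and> (if j then Y1 else Y0) \<noteq> 0)"

definition hirz_coords :: "nat \<Rightarrow> bool \<Rightarrow> bool \<Rightarrow> hirz_point \<Rightarrow> complex \<times> complex" where
  "hirz_coords \<delta> i j = (\<lambda>(X0, X1, Y0, Y1).
     (if i then X0 / X1 else X1 / X0,
      (let Xi = (if i then X1 else X0)
       in if j then Y0 / (Xi ^ \<delta> * Y1) else Xi ^ \<delta> * Y1 / Y0)))"

lemma hirz_coords_invariant:
  assumes "l \<noteq> 0" "m \<noteq> 0"
  shows "in_hirz_chart i j (hirz_action \<delta> l m p) = in_hirz_chart i j p"
    and "hirz_coords \<delta> i j (hirz_action \<delta> l m p) = hirz_coords \<delta> i j p"
  using assms
  by (cases p; auto simp: in_hirz_chart_def hirz_coords_def hirz_action_def power_mult_distrib)+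

text \<open>
  The coordinates \<open>x = X1 / X0\<close>, \<open>y = X0 ^ \<delta> * Y1 / Y0\<close> of the affine plane as rational functions of
  the coordinates of the chart \<open>(i, j)\<close>; for the chart \<open>(1, 0)\<close> with coordinates \<open>(s, t)\<close> these are
  \<open>x = 1 / s\<close> and \<open>y = s ^ \<delta> * t\<close>.
\<close>

definition hirz_transition :: "nat \<Rightarrow> bool \<Rightarrow> bool \<Rightarrow> birat \<times> birat" where
  "hirz_transition \<delta> i j =
     (if i then inverse (rat var_x) else rat var_x,
      (if i then rat var_x ^ \<delta> else 1) * (if j then inverse (rat var_y) else rat var_y))"

definition rat_pullback :: "birat \<Rightarrow> birat \<Rightarrow> form \<Rightarrow> birat \<times> birat" where
  "rat_pullback \<phi> \<psi> = (\<lambda>(P, Q).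
     (bieval rcst P \<phi> \<psi> * rdx \<phi> + bieval rcst Q \<phi> \<psi> * rdx \<psi>,
      bieval rcst P \<phi> \<psi> * rdy \<phi> + bieval rcst Q \<phi> \<psi> * rdy \<psi>))"

text \<open>\<open>\<omega>\<close> defines, in the chart \<open>(i, j)\<close>, the extension of the foliation \<open>b dx - a dy = 0\<close>.\<close>

definition hirz_foliation :: "nat \<Rightarrow> bipoly \<Rightarrow> bipoly \<Rightarrow> bool \<Rightarrow> bool \<Rightarrow> form \<Rightarrow> bool" where
  "hirz_foliation \<delta> a b i j \<omega> \<longleftrightarrow>
     (case hirz_transition \<delta> i j of (\<phi>, \<psi>) \<Rightarrow>
      case rat_pullback \<phi> \<psi> (b, - a) of (R, S) \<Rightarrow>
        coprime (fst \<omega>) (snd \<omega>) \<and>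
        (\<exists>r. r \<noteq> 0 \<and> rat (fst \<omega>) = r * R \<and> rat (snd \<omega>) = r * S))"

text \<open>
  The form defining the foliation in a chart is unique up to a nonzero constant, and whether a
  point is dicritical does not depend on the chart containing it.
\<close>

definition hirz_dicritical :: "nat \<Rightarrow> bipoly \<Rightarrow> bipoly \<Rightarrow> hirz_point \<Rightarrow> bool" where
  "hirz_dicritical \<delta> a b p \<longleftrightarrow>
     (\<exists>i j \<omega>. in_hirz_chart i j p \<and> hirz_foliation \<delta> a b i j \<omega> \<and>
        dicritical (translate_form (hirz_coords \<delta> i j p) \<omega>))"

definition delta1 :: "bipoly \<Rightarrow> bipoly \<Rightarrow> nat" where
  "delta1 a b = (LEAST \<delta>. \<not> hirz_dicritical \<delta> a b (0, 1, 1, 0))"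

end

theory Submission
  imports Defs "HOL-Computational_Algebra.Field_as_Ring"
begin

text \<open>
  The point \<open>(0, 1; 1, 0)\<close> is dicritical exactly when it is a base point of the pencil spanned by \<open>f1\<close>
  and \<open>f2\<close>. Away from a base point the first integral (or its inverse) is regular, this persists
  under blowing up, and then the lowest order terms show that no terminal dicritical point can
  arise. At a base point one keeps blowing up base points of the transformed pencil until its
  initial forms are independent, which forces a terminal dicritical point; regular and simple points
  only produce regular and simple points, so all blown up points are ordinary singularities.

  In the chart \<open>x = 1 / s\<close>, \<open>y = s ^ \<delta> * t\<close> this turns the definition of \<open>\<delta>1\<close> into an inequality
  \<open>i \<le> N + \<delta>1 * j\<close> for all monomials \<open>x ^ i * y ^ j\<close> of the pencil, where \<open>x ^ N\<close> is itself such a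
  monomial, so that \<open>N\<close> is the degree of \<open>g(x, 0)\<close>. Combining it with the inequality for the swapped
  variables bounds \<open>i + j\<close>.
\<close>

section \<open>Substitution and derivations\<close>

text \<open>The chain of base points has to be shown finite without intersection theory. Its
  substitute is that some power of x and some power of y lie in the local ideal of the pencil: a
  blowup lowers the exponent belonging to the exceptional divisor by the order of the pencil. At the
  point at infinity such a power comes from coprimality. The polynomials f1 and f2 generate a
  nonzero polynomial r(x), and near s = 0 the function r(1/s) is a power of s, possibly negative,
  times a unit. The local computations are carried out in the coordinates x and w = y/x. There the
  equation expressing that G1/G2 is a first integral becomes an identity between expansions in x,
  and comparing the lowest coefficients decides whether a point is terminal dicritical. The same
  coordinates describe the blowup, so one formalism serves both purposes.\<close>

lemma comm_ring_hom_cst: "comm_ring_hom (cst :: complex \<Rightarrow> bipoly)"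
  by unfold_locales (simp_all add: cst_def one_pCons)

interpretation cst: inj_idom_hom "cst :: complex \<Rightarrow> bipoly"
  by unfold_locales (simp_all add: cst_def one_pCons)

interpretation rat: inj_idom_hom rat
  by unfold_locales (simp_all add: rat_def One_fract_def Zero_fract_def eq_fract)

interpretation rcst: inj_idom_hom rcst
  by unfold_locales (simp_all add: rcst_def rat.hom_add rat.hom_mult cst.hom_add cst.hom_mult)

text \<open>Each step multiplies by a single variable, so coefficient formulas such as
  \<open>coeff_polar\<close> follow by an index shift. Multiplying two arbitrary polynomials, as in
  \<open>bipoly_induct\<close>, suits homomorphisms and derivations instead.\<close>

lemma bipoly_Cons_induct [case_names zero const_x mult_y]:
  fixes p :: bipoly
  assumes "P 0" "\<And>c p. P p \<Longrightarrow> P (cst c + var_x * p)"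
    "\<And>p q. P [:q:] \<Longrightarrow> P p \<Longrightarrow> P ([:q:] + var_y * p)"
  shows "P p"
proof -
  have const: "P [:q:]" for q
  proof (induction q)
    case 0
    show ?case using assms(1) by simp
  next
    case (pCons c q)
    have "[:pCons c q:] = cst c + var_x * [:q:]"
      by (simp add: cst_def var_x_def)
    then show ?case using assms(2)[OF pCons.IH] by (simp only:)
  qed
  show ?thesis
  proof (induction p)
    case 0
    show ?case using assms by simp
  next
    case (pCons q p)
    have "pCons q p = [:q:] + var_y * p"
      by (simp add: var_y_def)
    then show ?case using assms(3)[OF const pCons.IH] by (simp only:)
  qed
qed

lemma bipoly_induct [case_names cst x y add mult]:
  fixes p :: bipoly
  assumes "\<And>c. P (cst c)" "P var_x" "P var_y"
    and "\<And>p q. P p \<Longrightarrow> P q \<Longrightarrow> P (p + q)" "\<And>p q. P p \<Longrightarrow> P q \<Longrightarrow> P (p * q)"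
  shows "P p"
proof (induction p rule: bipoly_Cons_induct)
  case zero
  show ?case using assms(1)[of 0] by simp
next
  case (const_x c p)
  show ?case by (intro assms const_x)
next
  case (mult_y p q)
  show ?case by (intro assms mult_y)
qed

lemma bieval_hom:
  fixes emb :: "complex \<Rightarrow> 'b::comm_ring_1"
  assumes "comm_ring_hom emb"
  shows "comm_ring_hom (\<lambda>p. bieval emb p u v)"
proof -
  interpret emb: comm_ring_hom emb by fact
  interpret m: map_poly_comm_ring_hom emb ..
  have inner: "comm_ring_hom (\<lambda>q. poly (map_poly emb q) u)"
    by unfold_locales (simp_all add: m.hom_add m.hom_mult)
  interpret inner: comm_ring_hom "\<lambda>q. poly (map_poly emb q) u" by fact
  interpret n: map_poly_comm_ring_hom "\<lambda>q. poly (map_poly emb q) u" ..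
  show ?thesis
    unfolding bieval_def by unfold_locales (simp_all add: n.hom_add n.hom_mult)
qed

lemma bieval_gens:
  fixes emb :: "complex \<Rightarrow> 'b::comm_ring_1"
  assumes "comm_ring_hom emb"
  shows "bieval emb (cst c) u v = emb c" "bieval emb var_x u v = u" "bieval emb var_y u v = v"
proof -
  interpret emb: comm_ring_hom emb by fact
  show "bieval emb (cst c) u v = emb c" "bieval emb var_x u v = u" "bieval emb var_y u v = v"
    by (simp_all add: bieval_def cst_def var_x_def var_y_def Polynomial.map_poly_pCons emb.hom_zero)
qed

lemma hom_bipoly_eqI:
  fixes H H' :: "bipoly \<Rightarrow> 'b::comm_ring_1"
  assumes "comm_ring_hom H" "comm_ring_hom H'"
    and "\<And>c. H (cst c) = H' (cst c)" "H var_x = H' var_x" "H var_y = H' var_y"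
  shows "H p = H' p"
proof -
  interpret H: comm_ring_hom H by fact
  interpret H': comm_ring_hom H' by fact
  show ?thesis
    by (induction p rule: bipoly_induct) (simp_all add: assms H.hom_add H'.hom_add H.hom_mult H'.hom_mult)
qed

lemma comm_ring_hom_compose:
  "comm_ring_hom f \<Longrightarrow> comm_ring_hom g \<Longrightarrow> comm_ring_hom (\<lambda>p. g (f p))"
proof -
  assume "comm_ring_hom f" "comm_ring_hom g"
  then interpret f: comm_ring_hom f + g: comm_ring_hom g by auto
  show "comm_ring_hom (\<lambda>p. g (f p))"
    by unfold_locales (simp_all add: f.hom_add g.hom_add f.hom_mult g.hom_mult)
qed

abbreviation subst :: "bipoly \<Rightarrow> bipoly \<Rightarrow> bipoly \<Rightarrow> bipoly" where
  "subst u v p \<equiv> bieval cst p u v"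

interpretation subst: comm_ring_hom "subst u v" for u v
  by (rule bieval_hom[OF comm_ring_hom_cst])

lemmas subst_gens [simp] = bieval_gens[OF comm_ring_hom_cst]

lemma subst_id: "subst var_x var_y p = p"
  by (rule hom_bipoly_eqI[OF subst.comm_ring_hom_axioms]) (unfold_locales, simp_all)

lemma subst_subst: "subst u v (subst u' v' p) = subst (subst u v u') (subst u v v') p"
  by (rule hom_bipoly_eqI[OF comm_ring_hom_compose[OF subst.comm_ring_hom_axioms subst.comm_ring_hom_axioms]
        subst.comm_ring_hom_axioms]) simp_all

interpretation swap_vars: comm_ring_hom swap_vars
  unfolding swap_vars_def by (rule subst.comm_ring_hom_axioms)

lemma swap_vars_gens [simp]:
  "swap_vars (cst c) = cst c" "swap_vars var_x = var_y" "swap_vars var_y = var_x"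
  by (simp_all add: swap_vars_def)

lemma swap_vars_swap_vars [simp]: "swap_vars (swap_vars p) = p"
  by (simp add: swap_vars_def subst_subst subst_id)

lemma dx_gens [simp]: "dx (cst c) = 0" "dx var_x = 1" "dx var_y = 0"
  by (simp_all add: dx_def cst_def var_x_def var_y_def Polynomial.map_poly_pCons pderiv_pCons one_pCons)

lemma dy_gens [simp]: "dy (cst c) = 0" "dy var_x = 0" "dy var_y = 1"
  by (simp_all add: dy_def cst_def var_x_def var_y_def pderiv_pCons one_pCons)

lemma dx_add: "dx (p + q) = dx p + dx q"
  by (intro poly_eqI) (simp add: dx_def coeff_map_poly pderiv_add)

lemma dy_add: "dy (p + q) = dy p + dy q"
  by (simp add: dy_def pderiv_add)

lemma dx_diff: "dx (p - q) = dx p - dx q"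
  by (intro poly_eqI) (simp add: dx_def coeff_map_poly pderiv_diff)

lemma dy_diff: "dy (p - q) = dy p - dy q"
  by (simp add: dy_def pderiv_diff)

lemma dx_0 [simp]: "dx 0 = 0" and dy_0 [simp]: "dy 0 = 0"
  by (simp_all add: dx_def dy_def)

lemma dx_1 [simp]: "dx 1 = 0" and dy_1 [simp]: "dy 1 = 0"
  using dx_gens(1)[of 1] dy_gens(1)[of 1] by simp_all

text \<open>\<open>D\<close> is abstract so that both partial derivatives are instances; a
  derivation vanishing on constants is determined by its values on the generators.\<close>

lemma chain_rule:
  assumes D_mult: "\<And>p q. D (p * q) = D p * q + p * D q" and D_add: "\<And>p q. D (p + q) = D p + D q"
    and D_cst: "\<And>c. D (cst c) = 0"
  shows "D (subst u v p) = subst u v (dx p) * D u + subst u v (dy p) * D v"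
  by (induction p rule: bipoly_induct)
     (simp_all add: D_mult D_add D_cst dx_add dy_add dx_mult dy_mult
       subst.hom_add subst.hom_mult algebra_simps)

lemmas dx_subst = chain_rule[of dx, OF dx_mult dx_add dx_gens(1)]
lemmas dy_subst = chain_rule[of dy, OF dy_mult dy_add dy_gens(1)]

lemma dx_swap_vars: "dx (swap_vars p) = swap_vars (dy p)"
  and dy_swap_vars: "dy (swap_vars p) = swap_vars (dx p)"
  by (simp_all add: swap_vars_def dx_subst dy_subst)

interpretation at_origin: comm_ring_hom at_origin
  by unfold_locales (simp_all add: at_origin_def)

lemma at_origin_gens [simp]:
  "at_origin (cst c) = c" "at_origin var_x = 0" "at_origin var_y = 0"
  by (simp_all add: at_origin_def cst_def var_x_def var_y_def)

lemma at_origin_subst: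
  assumes "at_origin u = 0" "at_origin v = 0"
  shows "at_origin (subst u v p) = at_origin p"
  by (rule hom_bipoly_eqI[OF comm_ring_hom_compose[OF subst.comm_ring_hom_axioms at_origin.comm_ring_hom_axioms]
        at_origin.comm_ring_hom_axioms]) (simp_all add: assms)

lemma at_origin_swap_vars [simp]: "at_origin (swap_vars p) = at_origin p"
  by (simp add: swap_vars_def at_origin_subst)

lemma var_x_nonzero [simp]: "(var_x :: bipoly) \<noteq> 0" and var_y_nonzero [simp]: "(var_y :: bipoly) \<noteq> 0"
  by (simp_all add: var_x_def var_y_def)

lemma var_x_power: "var_x ^ n = [:monom (1 :: complex) n:]"
  by (induction n) (simp_all add: var_x_def monom_0 monom_Suc one_pCons)

lemma var_y_power: "var_y ^ n = (monom 1 n :: bipoly)"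
  by (simp add: var_y_def monom_altdef)

lemma origin_expansion: "\<exists>A B. p = cst (at_origin p) + var_x * A + var_y * B"
proof -
  have "p = [:coeff p 0:] + var_y * (poly_shift 1 p)"
    by (intro poly_eqI) (auto simp: var_y_def coeff_poly_shift coeff_pCons split: nat.splits)
  moreover have "[:coeff p 0:] = cst (at_origin p) + var_x * [:poly_shift 1 (coeff p 0):]"
    by (intro poly_eqI)
       (auto simp: cst_def var_x_def at_origin_def poly_0_coeff_0 coeff_poly_shift coeff_pCons split: nat.splits)
  ultimately show ?thesis
    by metis
qed

section \<open>The order at the origin\<close>

text \<open>
  The outer variable of \<open>polar p\<close> is \<open>x\<close> and the inner one is the slope \<open>w = y / x\<close>, so that the
  coefficient of index \<open>m\<close> is the dehomogenization of the homogeneous part of degree \<open>m\<close>.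
\<close>

definition polar :: "bipoly \<Rightarrow> bipoly" where
  "polar = subst var_y (var_x * var_y)"

interpretation polar: comm_ring_hom polar
  unfolding polar_def by (rule subst.comm_ring_hom_axioms)

lemma polar_gens [simp]:
  "polar (cst c) = cst c" "polar var_x = var_y" "polar var_y = var_x * var_y"
  by (simp_all add: polar_def)

lemma coeff_var_y_mult [simp]:
  "coeff (var_y * p) 0 = 0" "coeff (var_y * p) (Suc m) = coeff p m"
  by (simp_all add: var_y_def)

lemma coeff_var_x_mult: "coeff (var_x * p) m = [:0, 1:] * coeff p m"
  by (simp add: var_x_def)

lemma coeff_cst_mult [simp]: "coeff (cst c * p) m = Polynomial.smult c (coeff p m)"
  by (simp add: cst_def)

text \<open>The monomial x^i y^j becomes w^j x^(i+j): the outer index is the total degree, the inner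
  one the exponent of y. Distinct monomials never collide, which later gives injectivity.\<close>

lemma coeff_polar:
  "coeff (coeff (polar p) m) j = (if j \<le> m then coeff (coeff p j) (m - j) else 0)"
proof (induction p arbitrary: m j rule: bipoly_Cons_induct)
  case zero
  show ?case by simp
next
  case (const_x c p)
  have "coeff (coeff (cst c) i) k = (if i = 0 \<and> k = 0 then c else 0)" for i k
    by (simp add: cst_def coeff_pCons split: nat.splits)
  then show ?case
    using const_x[of "m - 1" j]
    by (cases m) (auto simp: polar.hom_add polar.hom_mult coeff_pCons coeff_var_x_mult Suc_diff_le split: nat.splits)
next
  case (mult_y p q)
  show ?case
  proof (cases m)
    case 0
    then show ?thesis using mult_y(1)[of m j]
      by (auto simp: polar.hom_add polar.hom_mult mult.assoc coeff_var_x_mult coeff_pCons split: nat.splits)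
  next
    case (Suc n)
    then show ?thesis using mult_y(1)[of m j] mult_y(2)[of n "j - 1"]
      by (cases j) (auto simp: polar.hom_add polar.hom_mult mult.assoc coeff_var_x_mult coeff_pCons split: nat.splits)
  qed
qed

lemma polar_inject: "polar p = polar q \<longleftrightarrow> p = q"
proof
  assume eq: "polar p = polar q"
  have "coeff (coeff r j) i = coeff (coeff (polar r) (i + j)) j" for r i j
    by (simp add: coeff_polar)
  then show "p = q"
    using eq by (metis poly_eqI)
qed simp

lemma polar_eq_0_iff: "polar p = 0 \<longleftrightarrow> p = 0"
  using polar_inject[of p 0] by simp

lemma coeff_polar_0: "coeff (polar p) 0 = [:at_origin p:]"
  by (intro poly_eqI) (simp add: coeff_polar coeff_pCons at_origin_def poly_0_coeff_0 split: nat.splits)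

lemma coeff_hom_part:
  "coeff (coeff (hom_part m p) j) i = (if i + j = m then coeff (coeff p j) i else 0)"
proof -
  have "coeff (coeff (hom_part m p) j) i =
      (\<Sum>k\<le>m. if k = j then (if m - j = i then coeff (coeff p j) i else 0) else 0)"
    unfolding hom_part_def coeff_sum by (intro sum.cong) auto
  then show ?thesis
    by auto
qed

lemma polar_hom_part: "polar (hom_part m p) = monom (coeff (polar p) m) m"
  by (intro poly_eqI) (auto simp: coeff_polar coeff_hom_part)

lemma hom_part_eq_0_iff: "hom_part m p = 0 \<longleftrightarrow> coeff (polar p) m = 0"
  using polar_hom_part[of m p] polar_eq_0_iff[of "hom_part m p"] by simp

lemma polar_order_exists:
  assumes "p \<noteq> 0"
  obtains n where "coeff (polar p) n \<noteq> 0" "\<And>m. m < n \<Longrightarrow> coeff (polar p) m = 0"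
proof -
  have "\<exists>n. coeff (polar p) n \<noteq> 0"
    using assms polar_eq_0_iff[of p] leading_coeff_0_iff by blast
  then show ?thesis
    using that LeastI_ex[of "\<lambda>n. coeff (polar p) n \<noteq> 0"] not_less_Least[of _ "\<lambda>n. coeff (polar p) n \<noteq> 0"]
    by blast
qed

lemma form_order_lower:
  "m < form_order (P, Q) \<Longrightarrow> coeff (polar P) m = 0 \<and> coeff (polar Q) m = 0"
  using not_less_Least[of m "\<lambda>m. hom_part m P \<noteq> 0 \<or> hom_part m Q \<noteq> 0"]
  by (simp add: form_order_def hom_part_eq_0_iff)

lemma form_order_attained:
  assumes "(P, Q) \<noteq> (0, 0)"
  shows "coeff (polar P) (form_order (P, Q)) \<noteq> 0 \<or> coeff (polar Q) (form_order (P, Q)) \<noteq> 0"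
proof -
  have "\<exists>m. coeff (polar P) m \<noteq> 0 \<or> coeff (polar Q) m \<noteq> 0"
    using assms polar_order_exists by (metis prod.inject)
  then show ?thesis
    using LeastI_ex[of "\<lambda>m. hom_part m P \<noteq> 0 \<or> hom_part m Q \<noteq> 0"]
    by (simp add: form_order_def hom_part_eq_0_iff)
qed

lemma form_order_le:
  "coeff (polar P) m \<noteq> 0 \<or> coeff (polar Q) m \<noteq> 0 \<Longrightarrow> form_order (P, Q) \<le> m"
  using form_order_lower[of m P Q] by force

lemma coeff_polar_radial:
  "coeff (polar P + var_x * polar Q) m = coeff (polar P) m + [:0, 1:] * coeff (polar Q) m"
  by (simp add: coeff_var_x_mult)

text \<open>With y = w x the contraction x P + y Q of the form with the Euler field is x (P + w Q).
  Hence \<open>polar P + var_x * polar Q\<close> detects the terminal dicritical condition degree by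
  degree.\<close>

lemma radial_eq_0_iff:
  "var_x * hom_part m P + var_y * hom_part m Q = 0 \<longleftrightarrow> coeff (polar P + var_x * polar Q) m = 0"
proof -
  have "polar (var_x * hom_part m P + var_y * hom_part m Q) =
      var_y * monom (coeff (polar P + var_x * polar Q) m) m"
  proof -
    have "var_x * monom (coeff (polar Q) m) m = monom ([:0, 1:] * coeff (polar Q) m) m"
      by (intro poly_eqI) (simp add: coeff_var_x_mult)
    then have "polar (var_x * hom_part m P + var_y * hom_part m Q) =
       var_y * (monom (coeff (polar P) m) m + monom ([:0, 1:] * coeff (polar Q) m) m)"
      by (simp add: polar.hom_add polar.hom_mult polar_hom_part algebra_simps)
    then show ?thesis
      by (simp only: coeff_polar_radial add_monom)
  qed
  then show ?thesis
    using polar_eq_0_iff[of "var_x * hom_part m P + var_y * hom_part m Q"] by simp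
qed

lemma terminal_dicritical_iff:
  assumes "(P, Q) \<noteq> (0, 0)"
  shows "terminal_dicritical (P, Q) \<longleftrightarrow>
    coeff (polar P + var_x * polar Q) (form_order (P, Q)) = 0"
proof
  assume "coeff (polar P + var_x * polar Q) (form_order (P, Q)) = 0"
  \<comment> \<open>In degree 0 the condition reads p + w q = 0 with constants p and q, so both
    vanish; being singular is therefore automatic.\<close>
  moreover have "form_order (P, Q) \<noteq> 0"
  proof
    assume 0: "form_order (P, Q) = 0"
    from calculation 0 have "coeff (polar P) 0 = 0 \<and> coeff (polar Q) 0 = 0"
      unfolding coeff_polar_radial by (simp add: coeff_polar_0)
    then show False
      using form_order_attained[OF assms] 0 by simp
  qed
  ultimately show "terminal_dicritical (P, Q)"
    by (simp add: terminal_dicritical_def singular_def first_jet_def radial_eq_0_iff)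
qed (simp add: terminal_dicritical_def singular_def first_jet_def radial_eq_0_iff)

lemma coeff_mult_lowest:
  fixes p q :: "'a::comm_semiring_0 poly"
  assumes "\<And>i. i < m \<Longrightarrow> coeff p i = 0" "\<And>i. i < n \<Longrightarrow> coeff q i = 0"
  shows "coeff (p * q) (m + n) = coeff p m * coeff q n"
    and "i < m + n \<Longrightarrow> coeff (p * q) i = 0"
proof -
  have "coeff p k * coeff q (m + n - k) = (if k = m then coeff p m * coeff q n else 0)" if "k \<le> m + n" for k
    using that assms(1)[of k] assms(2)[of "m + n - k"] by (cases k m rule: linorder_cases) auto
  then show "coeff (p * q) (m + n) = coeff p m * coeff q n"
    unfolding coeff_mult by simp
next
  assume "i < m + n"
  then have "coeff p k * coeff q (i - k) = 0" if "k \<le> i" for k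
    using that assms(1)[of k] assms(2)[of "i - k"] by (cases "k < m") auto
  then show "coeff (p * q) i = 0"
    unfolding coeff_mult by simp
qed

lemma coeff_mult_highest:
  fixes p q :: "'a::comm_semiring_0 poly"
  assumes "degree p \<le> m" "degree q \<le> n"
  shows "coeff (p * q) (m + n) = coeff p m * coeff q n"
proof -
  have "coeff p k * coeff q (m + n - k) = (if k = m then coeff p m * coeff q n else 0)" if "k \<le> m + n" for k
    using that assms by (cases k m rule: linorder_cases) (auto simp: coeff_eq_0)
  then show ?thesis
    unfolding coeff_mult by simp
qed

section \<open>First integrals of a form\<close>

definition wedge :: "(bipoly \<Rightarrow> bipoly) \<Rightarrow> bipoly \<Rightarrow> bipoly \<Rightarrow> bipoly" where
  "wedge D G1 G2 = D G1 * G2 - G1 * D G2"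

text \<open>\<open>G1 / G2\<close> is constant along the foliation: \<open>(G2 dG1 - G1 dG2) \<and> (P dx + Q dy) = 0\<close>.\<close>

definition integral_of :: "bipoly \<Rightarrow> bipoly \<Rightarrow> form \<Rightarrow> bool" where
  "integral_of G1 G2 = (\<lambda>(P, Q). wedge dx G1 G2 * Q = wedge dy G1 G2 * P)"

lemma integral_of_swap: "integral_of G1 G2 \<omega> \<Longrightarrow> integral_of G2 G1 \<omega>"
  by (cases \<omega>) (simp add: integral_of_def wedge_def algebra_simps)

lemma integral_of_sub: "integral_of G1 G2 \<omega> \<Longrightarrow> integral_of (G1 - cst c * G2) G2 \<omega>"
  by (cases \<omega>) (simp add: integral_of_def wedge_def dx_diff dy_diff dx_mult dy_mult algebra_simps)

lemma wedge_scale: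
  assumes "\<And>p q. D (p * q) = D p * q + p * D q"
  shows "wedge D (e * G1) (e * G2) = e * e * wedge D G1 G2"
  by (simp add: wedge_def assms algebra_simps)

lemma integral_of_cancel:
  assumes "integral_of (e * G1) (e * G2) (e' * P, e' * Q)" "e \<noteq> 0" "e' \<noteq> 0"
  shows "integral_of G1 G2 (P, Q)"
proof -
  have "(e * e * e') * (wedge dx G1 G2 * Q) = (e * e * e') * (wedge dy G1 G2 * P)"
    using assms(1)
    unfolding integral_of_def prod.case wedge_scale[of dx, OF dx_mult] wedge_scale[of dy, OF dy_mult]
    by (simp only: ac_simps)
  then show ?thesis
    using assms(2,3) by (simp add: integral_of_def)
qed

lemma wedge_subst:
  assumes "\<And>p. D (subst u v p) = subst u v (dx p) * D u + subst u v (dy p) * D v"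
  shows "wedge D (subst u v G1) (subst u v G2) =
    subst u v (wedge dx G1 G2) * D u + subst u v (wedge dy G1 G2) * D v"
  by (simp add: wedge_def assms subst.hom_mult subst.hom_minus algebra_simps)

lemma integral_of_pullback:
  assumes "integral_of G1 G2 (P, Q)"
  shows "integral_of (subst u v G1) (subst u v G2) (pullback u v (P, Q))"
proof -
  have "subst u v (wedge dx G1 G2) * subst u v Q = subst u v (wedge dy G1 G2) * subst u v P"
    using assms by (simp add: integral_of_def flip: subst.hom_mult)
  \<comment> \<open>A 2-form pulls back with the Jacobian determinant as extra factor.\<close>
  then have "(dx u * dy v - dy u * dx v) * (subst u v (wedge dx G1 G2) * subst u v Q -
      subst u v (wedge dy G1 G2) * subst u v P) = 0"
    by simp
  then show ?thesis
    unfolding integral_of_def pullback_def prod.case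
      wedge_subst[of dx, OF dx_subst] wedge_subst[of dy, OF dy_subst]
    by (simp add: algebra_simps)
qed

text \<open>
  The identity \<open>(G2 dG1 - G1 dG2) \<and> \<omega> = 0\<close> in the coordinates \<open>x\<close>, \<open>w = y / x\<close>.
\<close>

lemma integral_of_polar:
  assumes "integral_of G1 G2 (P, Q)"
  shows "var_y * wedge dy (polar G1) (polar G2) * polar Q =
    wedge dx (polar G1) (polar G2) * (polar P + var_x * polar Q)"
proof -
  have "polar (wedge dx G1 G2) * polar Q = polar (wedge dy G1 G2) * polar P"
    using assms by (simp add: integral_of_def flip: polar.hom_mult)
  moreover have "wedge dy (polar G1) (polar G2) = polar (wedge dx G1 G2) + var_x * polar (wedge dy G1 G2)"
    and "wedge dx (polar G1) (polar G2) = var_y * polar (wedge dy G1 G2)"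
    unfolding polar_def wedge_subst[of dx, OF dx_subst] wedge_subst[of dy, OF dy_subst]
    by (simp_all add: dx_mult dy_mult mult.commute)
  ultimately show ?thesis
    by (simp add: algebra_simps)
qed

lemma coeff_euler: "coeff (var_y * dy p) m = of_nat m * coeff p m"
  by (cases m) (simp_all add: dy_def coeff_pderiv)

lemma coeff_dx: "coeff (dx p) m = pderiv (coeff p m)"
  by (simp add: dx_def coeff_map_poly)

text \<open>Multiplying by \<open>var_y\<close> turns \<open>dy\<close> into the Euler operator,
  which scales the coefficient of index m by m. The lowest term of the radial wedge is thus weighted
  by the difference of the two orders, while that of the other wedge is the Wronskian of the initial
  forms.\<close>

lemma coeff_wedge_lowest:
  assumes "\<And>i. i < m \<Longrightarrow> coeff p i = 0" "\<And>i. i < n \<Longrightarrow> coeff q i = 0"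
  shows "coeff (var_y * wedge dy p q) (m + n) = (of_nat m - of_nat n) * (coeff p m * coeff q n)"
    and "i < m + n \<Longrightarrow> coeff (var_y * wedge dy p q) i = 0"
    and "coeff (wedge dx p q) (m + n) = pderiv (coeff p m) * coeff q n - coeff p m * pderiv (coeff q n)"
    and "i < m + n \<Longrightarrow> coeff (wedge dx p q) i = 0"
proof -
  have [simp]: "coeff (var_y * dy p) i = 0" "coeff (dx p) i = 0" if "i < m" for i
    using that assms by (simp_all add: coeff_euler coeff_dx)
  have [simp]: "coeff (var_y * dy q) i = 0" "coeff (dx q) i = 0" if "i < n" for i
    using that assms by (simp_all add: coeff_euler coeff_dx)
  have euler: "var_y * wedge dy p q = (var_y * dy p) * q - p * (var_y * dy q)"
    by (simp add: wedge_def algebra_simps)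
  show "coeff (var_y * wedge dy p q) (m + n) = (of_nat m - of_nat n) * (coeff p m * coeff q n)"
    unfolding euler coeff_diff
    by (subst (1 2) coeff_mult_lowest(1)) (simp_all add: assms coeff_euler algebra_simps del: coeff_var_y_mult)
  show "i < m + n \<Longrightarrow> coeff (var_y * wedge dy p q) i = 0"
    unfolding euler coeff_diff
    by (subst (1 2) coeff_mult_lowest(2)[of m _ n]) (simp_all add: assms)
  show "coeff (wedge dx p q) (m + n) = pderiv (coeff p m) * coeff q n - coeff p m * pderiv (coeff q n)"
    unfolding wedge_def coeff_diff
    by (subst (1 2) coeff_mult_lowest(1)) (simp_all add: assms coeff_dx)
  show "i < m + n \<Longrightarrow> coeff (wedge dx p q) i = 0"
    unfolding wedge_def coeff_diff
    by (subst (1 2) coeff_mult_lowest(2)[of m _ n]) (simp_all add: assms)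
qed

text \<open>Both orders are n, so in \<open>integral_of_polar\<close> the radial wedge loses its
  term of degree 2n while the Wronskian on the other side is nonzero. The lowest coefficient of the
  contracted form must therefore vanish.\<close>

lemma terminal_dicritical_if_initial_forms_independent:
  assumes int: "integral_of G1 G2 (P, Q)" and nz: "(P, Q) \<noteq> (0, 0)"
    and low: "\<And>i. i < n \<Longrightarrow> coeff (polar G1) i = 0" "\<And>i. i < n \<Longrightarrow> coeff (polar G2) i = 0"
    and ind: "pderiv (coeff (polar G1) n) * coeff (polar G2) n \<noteq> coeff (polar G1) n * pderiv (coeff (polar G2) n)"
  shows "terminal_dicritical (P, Q)"
proof -
  let ?m = "form_order (P, Q)" and ?R = "polar P + var_x * polar Q"
  let ?L = "var_y * wedge dy (polar G1) (polar G2)" and ?W = "wedge dx (polar G1) (polar G2)"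
  note lowest = coeff_wedge_lowest[of n "polar G1" n "polar G2", OF low, simplified]
  have Rlow: "coeff ?R i = 0" if "i < ?m" for i
    unfolding coeff_polar_radial using form_order_lower[OF that] by simp
  have "coeff ?L i = 0" if "i < Suc (n + n)" for i
    using that lowest(1) lowest(2)[of i] by (cases "i = n + n") auto
  then have "coeff (?L * polar Q) (n + n + ?m) = 0"
    by (rule coeff_mult_lowest(2)[of "Suc (n + n)" _ ?m]) (use form_order_lower in auto)
  also have "?L * polar Q = ?W * ?R"
    using integral_of_polar[OF int] .
  also have "coeff (?W * ?R) (n + n + ?m) = coeff ?W (n + n) * coeff ?R ?m"
    by (intro coeff_mult_lowest(1) lowest(4) Rlow)
  finally have "coeff ?R ?m = 0"
    using ind lowest(3) by simp
  then show ?thesis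
    by (simp add: terminal_dicritical_iff[OF nz])
qed

text \<open>After subtracting its value at the point the integral has positive order k over a unit.
  At a terminal dicritical point only the radial side of \<open>integral_of_polar\<close> has a term
  in the lowest degree; its factor k is nonzero, which forces the initial forms of Q and then of P
  to vanish.\<close>

lemma not_terminal_dicritical_if_integral_regular:
  assumes int: "integral_of G1 G2 (P, Q)" and nz: "(P, Q) \<noteq> (0, 0)"
    and "at_origin G2 \<noteq> 0" and nonconst: "\<And>c. G1 \<noteq> cst c * G2"
  shows "\<not> terminal_dicritical (P, Q)"
proof
  assume "terminal_dicritical (P, Q)"
  let ?m = "form_order (P, Q)" and ?R = "polar P + var_x * polar Q"
  define c where "c = at_origin G1 / at_origin G2"
  define H where "H = G1 - cst c * G2"
  let ?L = "var_y * wedge dy (polar H) (polar G2)" and ?W = "wedge dx (polar H) (polar G2)"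
  have "H \<noteq> 0"
    using nonconst[of c] by (simp add: H_def)
  then obtain k where k: "coeff (polar H) k \<noteq> 0" and low: "\<And>i. i < k \<Longrightarrow> coeff (polar H) i = 0"
    by (rule polar_order_exists) blast
  have "at_origin H = 0"
    using \<open>at_origin G2 \<noteq> 0\<close> by (simp add: H_def c_def at_origin.hom_minus at_origin.hom_mult)
  then have "k \<noteq> 0"
    using k coeff_polar_0[of H] by (metis pCons_0_0)
  note lowest = coeff_wedge_lowest[of k "polar H" 0 "polar G2", OF low, simplified]
  have R0: "coeff ?R ?m = 0"
    using \<open>terminal_dicritical (P, Q)\<close> by (simp only: terminal_dicritical_iff[OF nz])
  have Rlow: "coeff ?R i = 0" if "i < Suc ?m" for i
    using form_order_lower[of i P Q] that R0 unfolding coeff_polar_radial by (cases "i = ?m") auto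
  have "coeff ?L k * coeff (polar Q) ?m = coeff (?L * polar Q) (k + ?m)"
    by (intro coeff_mult_lowest(1)[symmetric] lowest(2)) (use form_order_lower in auto)
  also have "?L * polar Q = ?W * ?R"
    by (rule integral_of_polar) (simp add: H_def integral_of_sub int)
  also have "coeff (?W * ?R) (k + ?m) = 0"
    by (rule coeff_mult_lowest(2)[of k _ "Suc ?m"]) (use lowest(4) Rlow in auto)
  finally have "coeff (polar Q) ?m = 0"
    using lowest(1) k \<open>k \<noteq> 0\<close> \<open>at_origin G2 \<noteq> 0\<close> coeff_polar_0[of G2] by simp
  moreover from this R0 have "coeff (polar P) ?m = 0"
    unfolding coeff_polar_radial by simp
  ultimately show False
    using form_order_attained[OF nz] by simp
qed

text \<open>The constant is chosen so that r = p - c q, if nonzero, has a degree different from that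
  of q. The Wronskian of r and q, multiplied by the variable to keep degrees, would then have the
  coefficient (deg r - deg q) times both leading coefficients, which is nonzero.\<close>

lemma proportional_if_wronskian_0:
  fixes p q :: "complex poly"
  assumes W: "pderiv p * q = p * pderiv q" and "q \<noteq> 0"
  shows "\<exists>c. p = Polynomial.smult c q"
proof -
  define c where "c = (if degree p = degree q then lead_coeff p / lead_coeff q else 0)"
  define r where "r = p - Polynomial.smult c q"
  have Wr: "pderiv r * q = r * pderiv q"
    using W by (simp add: r_def pderiv_diff pderiv_smult algebra_simps)
  have "r = 0"
  proof (rule ccontr)
    assume "r \<noteq> 0"
    have ne: "degree r \<noteq> degree q"
    proof (cases "degree p = degree q")
      case True
      have "coeff r (degree q) = 0"
        using True \<open>q \<noteq> 0\<close> by (simp add: r_def c_def)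
      then show ?thesis
        using \<open>r \<noteq> 0\<close> by (metis leading_coeff_0_iff)
    qed (simp add: r_def c_def)
    have lead: "coeff (pCons 0 (pderiv s)) (degree s) = of_nat (degree s) * lead_coeff s" for s :: "complex poly"
      by (cases "degree s") (simp_all add: coeff_pderiv)
    have deg: "degree (pCons 0 (pderiv s)) \<le> degree s" for s :: "complex poly"
      by (rule degree_le) (auto simp: coeff_pCons coeff_pderiv coeff_eq_0 split: nat.splits)
    have "coeff (pCons 0 (pderiv r) * q) (degree r + degree q) =
        of_nat (degree r) * lead_coeff r * lead_coeff q"
      by (subst coeff_mult_highest[OF deg le_refl]) (simp add: lead)
    moreover have "coeff (r * pCons 0 (pderiv q)) (degree r + degree q) =
        lead_coeff r * (of_nat (degree q) * lead_coeff q)"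
      by (subst coeff_mult_highest[OF le_refl deg]) (simp add: lead)
    moreover have "pCons 0 (pderiv r) * q = r * pCons 0 (pderiv q)"
      using Wr by simp
    ultimately show False
      using ne \<open>r \<noteq> 0\<close> \<open>q \<noteq> 0\<close> by simp
  qed
  then show ?thesis
    by (auto simp: r_def)
qed

section \<open>Simple singularities\<close>

lemma at_origin_dx: "at_origin (dx p) = coeff (coeff p 0) 1"
  and at_origin_dy: "at_origin (dy p) = coeff (coeff p 1) 0"
  by (simp_all add: at_origin_def poly_0_coeff_0 dx_def dy_def coeff_map_poly coeff_pderiv)

lemma coeff_polar_1: "coeff (polar p) 1 = [:at_origin (dx p), at_origin (dy p):]"
  by (intro poly_eqI)
     (auto simp: coeff_polar coeff_pCons at_origin_dx at_origin_dy split: nat.splits)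

lemma form_order_eq_0: "at_origin P \<noteq> 0 \<or> at_origin Q \<noteq> 0 \<Longrightarrow> form_order (P, Q) = 0"
  using form_order_le[of P 0 Q] by (auto simp: coeff_polar_0)

lemma form_order_0D: "(P, Q) \<noteq> (0, 0) \<Longrightarrow> form_order (P, Q) = 0 \<Longrightarrow> at_origin P \<noteq> 0 \<or> at_origin Q \<noteq> 0"
  using form_order_attained[of P Q] by (auto simp: coeff_polar_0)

lemma form_order_1D: "form_order (P, Q) = 1 \<Longrightarrow> at_origin P = 0 \<and> at_origin Q = 0"
  using form_order_lower[of 0 P Q] by (auto simp: coeff_polar_0)

lemma form_order_eq_1:
  assumes "at_origin P = 0" "at_origin Q = 0"
    and "at_origin (dx P) \<noteq> 0 \<or> at_origin (dy P) \<noteq> 0 \<or> at_origin (dx Q) \<noteq> 0 \<or> at_origin (dy Q) \<noteq> 0"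
  shows "form_order (P, Q) = 1"
proof -
  have nz: "coeff (polar P) 1 \<noteq> 0 \<or> coeff (polar Q) 1 \<noteq> 0"
    unfolding coeff_polar_1 using assms(3) by auto
  then have "(P, Q) \<noteq> (0, 0)"
    by auto
  then have "form_order (P, Q) \<noteq> 0"
    using form_order_0D assms(1,2) by blast
  then show ?thesis
    using form_order_le[OF nz] by simp
qed

text \<open>Detached from the matrix, so that the effect of a blowup can be followed on the
  eigenvalues alone.\<close>

definition simple_pair :: "complex \<Rightarrow> complex \<Rightarrow> bool" where
  "simple_pair l1 l2 \<longleftrightarrow> l1 * l2 \<noteq> 0 \<and> \<not> (\<exists>r::rat. r > 0 \<and> l1 / l2 = of_rat r) \<or>
     l1 * l2 = 0 \<and> l1\<^sup>2 + l2\<^sup>2 \<noteq> 0"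

lemma char_poly_2:
  "char_poly (mat_of_rows_list 2 [[a, b], [c, d]]) = [:a * d - b * c, - (a + d), 1 :: complex:]"
proof -
  define M where "M = char_poly_matrix (mat_of_rows_list 2 [[a, b], [c, d]])"
  have M: "M \<in> carrier_mat 2 2"
    unfolding M_def by (intro char_poly_matrix_closed) (simp add: mat_of_rows_list_def numeral_2_eq_2)
  have "mat_delete M 0 j \<in> carrier_mat 1 1" for j
    using mat_delete_carrier[OF M, of 0 j] by simp
  then have "det M = (\<Sum>j<2. M $$ (0, j) * ((-1) ^ j * mat_delete M 0 j $$ (0, 0)))"
    using laplace_expansion_row[OF M, of 0] by (simp add: cofactor_def det_single)
  also have "\<dots> = M $$ (0, 0) * M $$ (1, 1) - M $$ (0, 1) * M $$ (1, 0)"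
    using M by (simp add: numeral_2_eq_2 mat_delete_def)
  also have "\<dots> = [:a * d - b * c, - (a + d), 1:]"
    by (simp add: M_def char_poly_matrix_def mat_of_rows_list_def numeral_2_eq_2)
  finally show ?thesis
    by (simp add: char_poly_def M_def)
qed

lemma simple_singularity_iff:
  "simple_singularity (P, Q) \<longleftrightarrow> form_order (P, Q) = 1 \<and>
     (\<exists>l1 l2. l1 + l2 = at_origin (dx Q) - at_origin (dy P) \<and>
        l1 * l2 = at_origin (dy Q) * at_origin (dx P) - at_origin (dx Q) * at_origin (dy P) \<and>
        simple_pair l1 l2)"
proof (cases "form_order (P, Q) = 1")
  case True
  have "at_origin (dx (hom_part 1 R)) = at_origin (dx R)" "at_origin (dy (hom_part 1 R)) = at_origin (dy R)" for R
    by (simp_all add: at_origin_dx at_origin_dy coeff_hom_part)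
  then have lin: "linear_part (P, Q) = mat_of_rows_list 2
      [[at_origin (dx Q), at_origin (dy Q)], [- at_origin (dx P), - at_origin (dy P)]]"
    using True by (simp add: linear_part_def first_jet_def)
  have "char_poly (linear_part (P, Q)) = [:- l1, 1:] * [:- l2, 1:] \<longleftrightarrow>
      l1 + l2 = at_origin (dx Q) - at_origin (dy P) \<and>
      l1 * l2 = at_origin (dy Q) * at_origin (dx P) - at_origin (dx Q) * at_origin (dy P)" for l1 l2
    unfolding lin char_poly_2 by (auto simp: algebra_simps)
  then show ?thesis
    using True by (simp add: simple_singularity_def simple_pair_def)
qed (simp add: simple_singularity_def)

lemma simple_pair_commute: "simple_pair l1 l2 \<Longrightarrow> simple_pair l2 l1"
proof -
  have "r > 0 \<Longrightarrow> l2 / l1 = of_rat r \<Longrightarrow> \<exists>r'>0. l1 / l2 = of_rat r'" for r :: rat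
    by (rule exI[of _ "inverse r"]) (metis inverse_divide of_rat_inverse positive_imp_inverse_positive)
  then show "simple_pair l1 l2 \<Longrightarrow> simple_pair l2 l1"
    unfolding simple_pair_def by (auto simp: add.commute)
qed

lemma simple_pair_neq: "simple_pair l1 l2 \<Longrightarrow> l1 \<noteq> l2"
  unfolding simple_pair_def by (auto dest: spec[of _ 1])

text \<open>The ratio -1 is rational but not positive. Such a saddle is the only singularity created
  by blowing up a regular point.\<close>

lemma simple_pair_neg: "l \<noteq> 0 \<Longrightarrow> simple_pair l (- l)"
proof -
  have "of_rat r \<noteq> (-1 :: complex)" if "r > 0" for r :: rat
  proof
    assume "of_rat r = (-1 :: complex)"
    then have "r = -1"
      by (metis of_rat_eq_iff of_rat_minus of_rat_1)
    then show False using that by simp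
  qed
  then show "l \<noteq> 0 \<Longrightarrow> simple_pair l (- l)"
    unfolding simple_pair_def by (auto dest: sym)
qed

text \<open>The eigenvalues at the singular points of the blowup of a simple singularity.\<close>

lemma simple_pair_diff:
  assumes "simple_pair l1 l2"
  shows "simple_pair l1 (l2 - l1)"
proof (cases "l1 = 0 \<or> l2 = 0")
  case True
  then show ?thesis
    using assms simple_pair_neg[of l1] by (auto simp: simple_pair_def)
next
  case False
  have "\<exists>r'>0. l2 / l1 = of_rat r'" if "r > 0" "l1 / (l2 - l1) = of_rat r" for r :: rat
  proof (intro exI[of _ "1 + inverse r"] conjI)
    have "(l2 - l1) / l1 = inverse (of_rat r)"
      using that False by (metis inverse_divide)
    then show "l2 / l1 = of_rat (1 + inverse r)"
      using False by (simp add: of_rat_add of_rat_inverse diff_divide_distrib diff_eq_eq add.commute)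
  qed (use \<open>r > 0\<close> in \<open>simp add: pos_add_strict\<close>)
  then show ?thesis
    using False simple_pair_commute[OF assms] simple_pair_neq[OF assms] by (auto simp: simple_pair_def)
qed

text \<open>In order 1 the terminal dicritical condition makes the linear part scalar. Its
  eigenvalues coincide, which \<open>simple_pair_neq\<close> forbids.\<close>

lemma terminal_dicritical_ordinary:
  assumes "(P, Q) \<noteq> (0, 0)" "terminal_dicritical (P, Q)"
  shows "ordinary_singularity (P, Q)"
proof -
  have "\<not> simple_singularity (P, Q)"
  proof
    assume simple: "simple_singularity (P, Q)"
    then have 1: "form_order (P, Q) = 1"
      by (simp add: simple_singularity_def)
    have "coeff (polar P) 1 + [:0, 1:] * coeff (polar Q) 1 = 0"
      using assms unfolding terminal_dicritical_iff[OF assms(1)] 1 coeff_polar_radial by simp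
    then have "at_origin (dx P) = 0" "at_origin (dy P) = - at_origin (dx Q)" "at_origin (dy Q) = 0"
      by (simp_all only: coeff_polar_1) (simp_all add: eq_neg_iff_add_eq_0)
    then obtain l1 l2 where "l1 + l2 = 2 * at_origin (dx Q)" "l1 * l2 = (at_origin (dx Q))\<^sup>2"
      and pair: "simple_pair l1 l2"
      using simple by (auto simp: simple_singularity_iff power2_eq_square)
    then have "(l1 + l2)\<^sup>2 = 4 * (l1 * l2)"
      by (simp add: power_mult_distrib)
    then have "(l1 - l2)\<^sup>2 = 0"
      by (simp add: power2_eq_square algebra_simps)
    then show False
      using simple_pair_neq[OF pair] by simp
  qed
  then show ?thesis
    using assms(2) by (simp add: ordinary_singularity_def terminal_dicritical_def)
qed

section \<open>Strict transforms\<close>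

lemma blowup_chart_facts:
  assumes "blowup_chart d = (\<phi>, \<psi>, e)"
  shows "at_origin \<phi> = 0" "at_origin \<psi> = 0" "at_origin e = 0" "e = var_x \<or> e = var_y"
    "dx \<phi> * dy \<psi> - dy \<phi> * dx \<psi> = e"
  using assms
  by (cases d; auto simp: at_origin.hom_add at_origin.hom_mult dx_mult dy_mult dx_add dy_add)+

text \<open>Cancelling powers of \<open>e\<close> shows that the exponent in a strict transform is
  unique, so exhibiting one factorization with maximal exponent identifies it.\<close>

lemma strict_transform_eqI:
  assumes st: "strict_transform \<omega> d \<eta>" and chart: "blowup_chart d = (\<phi>, \<psi>, e)"
    and pb: "pullback \<phi> \<psi> \<omega> = (e ^ k * A, e ^ k * B)" and max: "\<not> (e dvd A \<and> e dvd B)"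
  shows "\<eta> = (A, B)"
proof -
  have e: "e \<noteq> 0"
    using blowup_chart_facts(4)[OF chart] by auto
  obtain l where l: "pullback \<phi> \<psi> \<omega> = (e ^ l * fst \<eta>, e ^ l * snd \<eta>)"
    and max': "\<not> (e dvd fst \<eta> \<and> e dvd snd \<eta>)"
    using st chart by (auto simp: strict_transform_def)
  have le: "m \<le> n" if "e ^ m * C = e ^ n * C'" "e ^ m * D = e ^ n * D'" "\<not> (e dvd C' \<and> e dvd D')"
    for m n C C' D D'
  proof (rule ccontr)
    assume "\<not> m \<le> n"
    then obtain i where i: "m = n + Suc i"
      by (metis add_Suc_right less_imp_Suc_add not_le)
    then have "e ^ n * (e * (e ^ i * C)) = e ^ n * C'" "e ^ n * (e * (e ^ i * D)) = e ^ n * D'"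
      using that by (simp_all add: power_add mult.assoc)
    then have "C' = e * (e ^ i * C)" "D' = e * (e ^ i * D)"
      using e by simp_all
    then show False
      using that(3) by simp
  qed
  have eqs: "e ^ k * A = e ^ l * fst \<eta>" "e ^ k * B = e ^ l * snd \<eta>"
    using l pb by auto
  have "k = l"
    using le[OF eqs max'] le[OF eqs[symmetric] max] by simp
  then show ?thesis
    using eqs e by (cases \<eta>) simp
qed

text \<open>Used backwards: an ordinary singularity above a point makes the point itself ordinary
  and hence an admissible centre. Over a regular point only a saddle with eigenvalues l, -l can
  arise; over a simple point the singularities sit at the eigendirections, with eigenvalues l1, l2 -
  l1 or l2, l1 - l2.\<close>

lemma not_ordinary_strict_transform:
  assumes nz: "(P, Q) \<noteq> (0, 0)" and no: "\<not> ordinary_singularity (P, Q)"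
    and st: "strict_transform (P, Q) d \<eta>"
  shows "\<not> ordinary_singularity \<eta>"
proof -
  define p q where "p = at_origin P" and "q = at_origin Q"
  have reg: "\<not> ordinary_singularity (R, S)" if "at_origin R \<noteq> 0 \<or> at_origin S \<noteq> 0" for R S
    using form_order_eq_0[OF that] by (simp add: ordinary_singularity_def singular_def)
  have simp': "\<not> ordinary_singularity (R, S)"
    if "at_origin R = 0" "at_origin S = 0" "simple_pair l1 l2"
      "l1 + l2 = at_origin (dx S) - at_origin (dy R)"
      "l1 * l2 = at_origin (dy S) * at_origin (dx R) - at_origin (dx S) * at_origin (dy R)" for R S l1 l2
  proof -
    have "at_origin (dx R) \<noteq> 0 \<or> at_origin (dy R) \<noteq> 0 \<or> at_origin (dx S) \<noteq> 0 \<or> at_origin (dy S) \<noteq> 0"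
    proof (rule ccontr)
      assume "\<not> ?thesis"
      then have "l1 + l2 = 0" "l1 * l2 = 0"
        using that by simp_all
      then have "l1 = l2"
        by auto
      then show False
        using simple_pair_neq that(3) by blast
    qed
    then have "form_order (R, S) = 1"
      using that by (intro form_order_eq_1) auto
    then show ?thesis
      using that by (auto simp: ordinary_singularity_def simple_singularity_iff)
  qed
  note simps = at_origin.hom_add at_origin.hom_mult dx_mult dy_mult dx_add dy_add dx_subst dy_subst
  have two: "at_origin 2 = 2" "dx 2 = 0" "dy 2 = 0"
    using at_origin.hom_add[of 1 1] dx_add[of 1 1] dy_add[of 1 1] by simp_all
  \<comment> \<open>A multiple of x vanishes on x = 0 together with all its y-derivatives. Two
    derivatives are enough because the form found over a simple point restricts to a polynomial of
    degree at most 2 on the exceptional divisor.\<close>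
  have not_dvd_x: "\<not> var_x dvd F" if "at_origin F \<noteq> 0 \<or> at_origin (dy F) \<noteq> 0 \<or> at_origin (dy (dy F)) \<noteq> 0" for F
    using that by (auto simp: simps elim!: dvdE)
  have not_dvd_y: "\<not> var_y dvd F" if "at_origin F \<noteq> 0 \<or> at_origin (dx F) \<noteq> 0 \<or> at_origin (dx (dx F)) \<noteq> 0" for F
    using that by (auto simp: simps elim!: dvdE)
  consider (regular) "p \<noteq> 0 \<or> q \<noteq> 0" | (simple) "simple_singularity (P, Q)"
    using no form_order_0D[OF nz] by (auto simp: ordinary_singularity_def singular_def p_def q_def)
  then show ?thesis
  proof cases
    case regular
    show ?thesis
    proof (cases d)
      case (Slope c)
      define s where "s = subst var_x (var_x * (var_y + cst c))"
      define F G where "F = s P + s Q * (var_y + cst c)" and "G = s Q * var_x"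
      have pb: "pullback var_x (var_x * (var_y + cst c)) (P, Q) = (F, G)"
        by (simp add: pullback_def F_def G_def s_def simps)
      have s0: "at_origin (s R) = at_origin R" for R
        by (simp add: s_def at_origin_subst simps)
      have F0: "at_origin F = p + c * q" and Fy: "at_origin (dy F) = q"
        and G0: "at_origin G = 0" and Gx: "at_origin (dx G) = q" and Gy: "at_origin (dy G) = 0"
        using s0[of P] s0[of Q] by (simp_all add: F_def G_def p_def q_def simps) (simp_all add: s_def simps)
      have "\<not> var_x dvd F"
        using regular F0 Fy by (intro not_dvd_x) auto
      then have \<eta>: "\<eta> = (F, G)"
        by (intro strict_transform_eqI[OF st, of var_x "var_x * (var_y + cst c)" var_x 0]) (simp_all add: Slope pb)
      show ?thesis
      proof (cases "p + c * q = 0")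
        case True
        then have "q \<noteq> 0"
          using regular by auto
        then show ?thesis
          unfolding \<eta> using True
          by (intro simp'[of _ _ q "- q"] simple_pair_neg) (simp_all add: F0 Fy G0 Gx Gy)
      next
        case False
        then show ?thesis
          unfolding \<eta> by (intro reg) (simp add: F0)
      qed
    next
      case Vertical
      define s where "s = subst (var_x * var_y) var_y"
      define F G where "F = s P * var_y" and "G = s P * var_x + s Q"
      have pb: "pullback (var_x * var_y) var_y (P, Q) = (F, G)"
        by (simp add: pullback_def F_def G_def s_def simps)
      have s0: "at_origin (s R) = at_origin R" for R
        by (simp add: s_def at_origin_subst simps)
      have G0: "at_origin G = q" and Gx: "at_origin (dx G) = p"
        and F0: "at_origin F = 0" and Fx: "at_origin (dx F) = 0" and Fy: "at_origin (dy F) = p"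
        using s0[of P] s0[of Q] by (simp_all add: F_def G_def p_def q_def simps) (simp_all add: s_def simps)
      have "\<not> var_y dvd G"
        using regular G0 Gx by (intro not_dvd_y) auto
      then have \<eta>: "\<eta> = (F, G)"
        by (intro strict_transform_eqI[OF st, of "var_x * var_y" var_y var_y 0]) (simp_all add: Vertical pb)
      show ?thesis
      proof (cases "q = 0")
        case True
        then have "p \<noteq> 0"
          using regular by auto
        then show ?thesis
          unfolding \<eta> using True
          by (intro simp'[of _ _ p "- p"] simple_pair_neg) (simp_all add: F0 Fx Fy G0 Gx)
      next
        case False
        then show ?thesis
          unfolding \<eta> by (intro reg) (simp add: G0)
      qed
    qed
  next
    case simple
    define p10 p01 q10 q01 where coeffs: "p10 = at_origin (dx P)" "p01 = at_origin (dy P)"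
      "q10 = at_origin (dx Q)" "q01 = at_origin (dy Q)"
    obtain l1 l2 where trace: "l1 + l2 = q10 - p01" and det: "l1 * l2 = q01 * p10 - q10 * p01"
      and pair: "simple_pair l1 l2" and order: "form_order (P, Q) = 1"
      using simple by (auto simp: simple_singularity_iff coeffs)
    \<comment> \<open>A scalar linear part would have a double eigenvalue. Being nonscalar
      guarantees that exactly one power of the exceptional equation can be divided out
      below.\<close>
    have nonscalar: "p10 \<noteq> 0 \<or> p01 + q10 \<noteq> 0 \<or> q01 \<noteq> 0"
    proof (rule ccontr)
      assume "\<not> ?thesis"
      then have "p10 = 0" "p01 = - q10" "q01 = 0"
        by (auto simp: eq_neg_iff_add_eq_0)
      with trace det have "l1 + l2 = 2 * q10" "l1 * l2 = q10 * q10"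
        by simp_all
      moreover have "(l1 - l2) * (l1 - l2) = (l1 + l2) * (l1 + l2) - 4 * (l1 * l2)"
        by (simp add: algebra_simps)
      ultimately have "(l1 - l2) * (l1 - l2) = 0"
        by simp
      then show False
        using simple_pair_neq[OF pair] by simp
    qed
    have char: "(m - l1) * (m - l2) = m * m - m * (q10 - p01) + (q01 * p10 - q10 * p01)" for m
      unfolding trace[symmetric] det[symmetric] by (simp add: algebra_simps)
    have pair': "simple_pair m (l1 + l2 - 2 * m)" if "(m - l1) * (m - l2) = 0" for m
    proof -
      have "l1 + l2 - 2 * l1 = l2 - l1" "l1 + l2 - 2 * l2 = l1 - l2"
        by simp_all
      then show ?thesis
        using that simple_pair_diff[OF pair] simple_pair_diff[OF simple_pair_commute[OF pair]]
        by (metis eq_iff_diff_eq_0 mult_eq_0_iff)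
    qed
    have "at_origin P = 0" "at_origin Q = 0"
      using form_order_1D[OF order] by simp_all
    then obtain A B C D where P: "P = var_x * A + var_y * B" and Q: "Q = var_x * C + var_y * D"
      using origin_expansion[of P] origin_expansion[of Q] by (auto simp: cst.hom_zero)
    have AB: "at_origin A = p10" "at_origin B = p01" "at_origin C = q10" "at_origin D = q01"
      by (simp_all add: coeffs P Q simps)
    show ?thesis
    proof (cases d)
      case (Slope c)
      define s where "s = subst var_x (var_x * (var_y + cst c))"
      define w where "w = (var_y + cst c :: bipoly)"
      define F G where "F = s A + w * s B + w * (s C + w * s D)" and "G = var_x * (s C + w * s D)"
      have "pullback var_x (var_x * (var_y + cst c)) (P, Q) = (s P + s Q * w, s Q * var_x)"
        by (simp add: pullback_def s_def w_def simps)
      moreover have "s P = var_x * (s A + w * s B)" "s Q = var_x * (s C + w * s D)"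
        by (simp_all add: P Q s_def w_def subst.hom_add subst.hom_mult algebra_simps)
      ultimately have pb: "pullback var_x (var_x * (var_y + cst c)) (P, Q) = (var_x ^ 1 * F, var_x ^ 1 * G)"
        by (simp add: F_def G_def algebra_simps)
      have s0: "at_origin (s R) = at_origin R" "at_origin (dy (s R)) = 0" "at_origin (dy (dy (s R))) = 0" for R
        by (simp_all add: s_def at_origin_subst simps)
      have w0: "at_origin w = c" "dx w = 0" "dy w = 1"
        by (simp_all add: w_def simps)
      have F0: "at_origin F = p10 + c * p01 + c * (q10 + c * q01)"
        and Fy: "at_origin (dy F) = p01 + q10 + 2 * c * q01" and Fyy: "at_origin (dy (dy F)) = 2 * q01"
        and G0: "at_origin G = 0" and Gx: "at_origin (dx G) = q10 + c * q01" and Gy: "at_origin (dy G) = 0"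
        by (simp_all add: F_def G_def simps(1-6) s0 w0 AB two algebra_simps)
      have "\<not> var_x dvd F"
      proof (rule not_dvd_x, rule ccontr)
        assume "\<not> (at_origin F \<noteq> 0 \<or> at_origin (dy F) \<noteq> 0 \<or> at_origin (dy (dy F)) \<noteq> 0)"
        then have "q01 = 0" "p01 + q10 = 0" "p10 + c * (p01 + q10) = 0"
          using F0 Fy Fyy by (auto simp: algebra_simps)
        then show False
          using nonscalar by simp
      qed
      then have \<eta>: "\<eta> = (F, G)"
        by (intro strict_transform_eqI[OF st _ pb]) (simp_all add: Slope)
      show ?thesis
      proof (cases "at_origin F = 0")
        case True
        \<comment> \<open>The first component of the linear part applied to (1, c). The point of
          slope c is singular exactly when (1, c) is an eigenvector, and \<open>m\<close> is its
          eigenvalue.\<close>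
        define m where "m = q10 + c * q01"
        have "(m - l1) * (m - l2) = q01 * at_origin F"
          unfolding char F0 m_def by (simp add: algebra_simps)
        then have "simple_pair m (l1 + l2 - 2 * m)"
          using True by (intro pair') simp
        then show ?thesis
          unfolding \<eta> using True
          by (intro simp') (auto simp: Fy G0 Gx Gy trace m_def algebra_simps)
      next
        case False
        then show ?thesis
          unfolding \<eta> by (intro reg) simp
      qed
    next
      case Vertical
      define s where "s = subst (var_x * var_y) var_y"
      define F G where "F = var_y * (var_x * s A + s B)"
        and "G = var_x * (var_x * s A + s B) + (var_x * s C + s D)"
      have "pullback (var_x * var_y) var_y (P, Q) = (s P * var_y, s P * var_x + s Q)"
        by (simp add: pullback_def s_def simps)
      moreover have "s P = var_y * (var_x * s A + s B)" "s Q = var_y * (var_x * s C + s D)"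
        by (simp_all add: P Q s_def subst.hom_add subst.hom_mult algebra_simps)
      ultimately have pb: "pullback (var_x * var_y) var_y (P, Q) = (var_y ^ 1 * F, var_y ^ 1 * G)"
        by (simp add: F_def G_def algebra_simps)
      have s0: "at_origin (s R) = at_origin R" "at_origin (dx (s R)) = 0" "at_origin (dx (dx (s R))) = 0" for R
        by (simp_all add: s_def at_origin_subst simps)
      have G0: "at_origin G = q01" and Gx: "at_origin (dx G) = p01 + q10"
        and Gxx: "at_origin (dx (dx G)) = 2 * p10"
        and F0: "at_origin F = 0" and Fx: "at_origin (dx F) = 0" and Fy: "at_origin (dy F) = p01"
        by (simp_all add: F_def G_def simps(1-6) s0 AB two algebra_simps)
      have "\<not> var_y dvd G"
        by (rule not_dvd_y) (use nonscalar G0 Gx Gxx in auto)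
      then have \<eta>: "\<eta> = (F, G)"
        by (intro strict_transform_eqI[OF st _ pb]) (simp_all add: Vertical)
      show ?thesis
      proof (cases "q01 = 0")
        case True
        \<comment> \<open>Here the eigenvector is (0, 1), with eigenvalue - p01.\<close>
        have "(- p01 - l1) * (- p01 - l2) = 0"
          unfolding char by (simp add: True algebra_simps)
        then have "simple_pair (- p01) (l1 + l2 - 2 * (- p01))"
          by (rule pair')
        then show ?thesis
          unfolding \<eta> using True
          by (intro simp') (auto simp: F0 Fx Fy G0 Gx trace algebra_simps)
      next
        case False
        then show ?thesis
          unfolding \<eta> by (intro reg) (simp add: G0)
      qed
    qed
  qed
qed

section \<open>Initial forms under blowing up\<close>

lemma coeff_swap_vars: "coeff (coeff (swap_vars p) j) i = coeff (coeff p i) j"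
proof (induction p arbitrary: i j rule: bipoly_Cons_induct)
  case zero
  show ?case by simp
next
  case (const_x c p)
  have "coeff (coeff (cst c) i) k = (if i = 0 \<and> k = 0 then c else 0)" for i k
    by (simp add: cst_def coeff_pCons split: nat.splits)
  then show ?case
    using const_x[of "j - 1" i]
    by (cases j) (auto simp: swap_vars.hom_add swap_vars.hom_mult coeff_var_x_mult)
next
  case (mult_y p q)
  show ?case
    using mult_y(1)[of j i] mult_y(2)[of j "i - 1"]
    by (cases i) (auto simp: swap_vars.hom_add swap_vars.hom_mult coeff_var_x_mult)
qed

lemma coeff_polar_swap_vars:
  "coeff (coeff (polar (swap_vars p)) m) j = (if j \<le> m then coeff (coeff (polar p) m) (m - j) else 0)"
  by (simp add: coeff_polar coeff_swap_vars)

text \<open>Restriction to x = 0, the exceptional divisor in the slope charts. In the vertical chart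
  that divisor is y = 0, and the restriction to it is \<open>coeff p 0\<close>.\<close>

definition along_y :: "bipoly \<Rightarrow> complex poly" where
  "along_y = map_poly (\<lambda>q. poly q 0)"

interpretation along_y: comm_ring_hom along_y
proof -
  interpret eval: comm_ring_hom "\<lambda>q :: complex poly. poly q 0"
    by unfold_locales simp_all
  interpret m: map_poly_comm_ring_hom "\<lambda>q :: complex poly. poly q 0" ..
  show "comm_ring_hom along_y"
    unfolding along_y_def by (rule m.comm_ring_hom_axioms)
qed

lemma coeff_along_y: "coeff (along_y p) j = coeff (coeff p j) 0"
  by (simp add: along_y_def coeff_map_poly poly_0_coeff_0)

lemma along_y_gens [simp]:
  "along_y (cst c) = [:c:]" "along_y var_x = 0" "along_y var_y = [:0, 1:]"
  by (simp_all add: along_y_def cst_def var_x_def var_y_def Polynomial.map_poly_pCons)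

lemma coeff_0_along_y: "coeff (along_y p) 0 = at_origin p"
  by (simp add: coeff_along_y at_origin_def poly_0_coeff_0)

lemma var_y_power_factor:
  fixes p :: bipoly
  assumes "\<And>i. i < n \<Longrightarrow> coeff p i = 0"
  shows "\<exists>r. p = var_y ^ n * r \<and> coeff r 0 = coeff p n"
proof (intro exI conjI)
  show "p = var_y ^ n * poly_shift n p"
    unfolding var_y_power by (rule poly_eqI) (simp add: coeff_monom_mult coeff_poly_shift assms)
qed (simp add: coeff_poly_shift)

text \<open>Up to renaming variables and translating the slope by c, this chart is
  \<open>polar\<close>. The power of x splits off because the polar expansion starts at index n, and
  what remains restricts on the exceptional divisor to the dehomogenized part of degree n.\<close>

lemma slope_factor:
  assumes "\<And>i. i < n \<Longrightarrow> coeff (polar p) i = 0"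
  shows "\<exists>p'. subst var_x (var_x * (var_y + cst c)) p = var_x ^ n * p' \<and>
    along_y p' = pcompose (coeff (polar p) n) [:c, 1:]"
proof -
  obtain r where r: "polar p = var_y ^ n * r" "coeff r 0 = coeff (polar p) n"
    using var_y_power_factor[of n "polar p"] assms by blast
  have "subst var_x (var_x * (var_y + cst c)) p = subst (var_y + cst c) var_x (polar p)"
    by (simp add: polar_def subst_subst subst.hom_mult mult.commute)
  also have "\<dots> = var_x ^ n * subst (var_y + cst c) var_x r"
    by (simp add: r(1) subst.hom_mult subst.hom_power)
  finally have "subst var_x (var_x * (var_y + cst c)) p = var_x ^ n * subst (var_y + cst c) var_x r" .
  moreover have "along_y (subst (var_y + cst c) var_x r) = pcompose (coeff r 0) [:c, 1:]"
  proof (rule hom_bipoly_eqI[OF comm_ring_hom_compose[OF subst.comm_ring_hom_axioms along_y.comm_ring_hom_axioms]])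
    show "comm_ring_hom (\<lambda>q :: bipoly. pcompose (coeff q 0) [:c, 1:])"
      by unfold_locales (simp_all add: pcompose_add pcompose_mult coeff_mult_0 pcompose_1)
  qed (simp_all add: along_y.hom_add, simp_all add: cst_def var_x_def var_y_def pcompose_pCons)
  ultimately show ?thesis
    using r(2) by metis
qed

text \<open>The vertical chart is the chart of slope 0 after exchanging the variables; the exchange
  reverses the coefficients of the dehomogenized part of degree n.\<close>

lemma vertical_factor:
  assumes "\<And>i. i < n \<Longrightarrow> coeff (polar p) i = 0"
  shows "\<exists>p'. subst (var_x * var_y) var_y p = var_y ^ n * p' \<and>
    (\<forall>j. coeff (coeff p' 0) j = (if j \<le> n then coeff (coeff (polar p) n) (n - j) else 0))"
proof -
  have "coeff (polar (swap_vars p)) i = 0" if "i < n" for i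
    by (intro poly_eqI) (simp add: coeff_polar_swap_vars assms that)
  then obtain r where r: "subst var_x (var_x * (var_y + cst 0)) (swap_vars p) = var_x ^ n * r"
      "along_y r = pcompose (coeff (polar (swap_vars p)) n) [:0, 1:]"
    using slope_factor[of n "swap_vars p" 0] by blast
  have "subst (var_x * var_y) var_y p = swap_vars (subst var_x (var_x * (var_y + cst 0)) (swap_vars p))"
    by (simp add: swap_vars_def subst_subst subst.hom_mult cst.hom_zero mult.commute)
  also have "\<dots> = var_y ^ n * swap_vars r"
    by (simp only: r(1) swap_vars.hom_mult swap_vars.hom_power swap_vars_gens)
  finally have "subst (var_x * var_y) var_y p = var_y ^ n * swap_vars r" .
  moreover have "coeff (coeff (swap_vars r) 0) j = coeff (coeff (polar (swap_vars p)) n) j" for j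
    using arg_cong[OF r(2), of "\<lambda>q. coeff q j"] by (simp add: coeff_swap_vars coeff_along_y pcompose_idR)
  ultimately show ?thesis
    using coeff_polar_swap_vars[of p n] by metis
qed

text \<open>A nonzero initial form survives as the restriction to the exceptional divisor, so
  nothing nonzero pulls back to zero.\<close>

lemma subst_blowup_chart_eq_0_iff:
  assumes chart: "blowup_chart d = (\<phi>, \<psi>, e)"
  shows "subst \<phi> \<psi> p = 0 \<longleftrightarrow> p = 0"
proof
  assume 0: "subst \<phi> \<psi> p = 0"
  show "p = 0"
  proof (rule ccontr)
    assume "p \<noteq> 0"
    then obtain n where n: "coeff (polar p) n \<noteq> 0" "\<And>i. i < n \<Longrightarrow> coeff (polar p) i = 0"
      by (rule polar_order_exists) blast
    show False
    proof (cases d)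
      case (Slope c)
      then obtain p' where "subst \<phi> \<psi> p = var_x ^ n * p'" "along_y p' = pcompose (coeff (polar p) n) [:c, 1:]"
        using slope_factor[OF n(2)] chart by auto
      then show False
        using 0 n(1) along_y.hom_zero pcompose_eq_0[of "coeff (polar p) n" "[:c, 1:]"] by auto
    next
      case Vertical
      then obtain p' where p': "subst \<phi> \<psi> p = var_y ^ n * p'"
          "\<And>j. coeff (coeff p' 0) j = (if j \<le> n then coeff (coeff (polar p) n) (n - j) else 0)"
        using vertical_factor[OF n(2)] chart by auto
      have "coeff (coeff (polar p) n) j = 0" for j
        using p'(2)[of "n - j"] p'(1) 0 coeff_polar[of p n j] by (cases "j \<le> n") auto
      then show False
        using n(1) poly_eqI[of "coeff (polar p) n" 0] by simp
    qed
  qed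
qed (simp add: subst.hom_zero)

section \<open>Existence of strict transforms and the transformed first integral\<close>

lemma pullback_blowup_chart_nonzero:
  assumes chart: "blowup_chart d = (\<phi>, \<psi>, e)" and "(P, Q) \<noteq> (0, 0)"
  shows "pullback \<phi> \<psi> (P, Q) \<noteq> (0, 0)"
proof
  let ?P = "subst \<phi> \<psi> P" and ?Q = "subst \<phi> \<psi> Q"
  assume "pullback \<phi> \<psi> (P, Q) = (0, 0)"
  then have 0: "?P * dx \<phi> + ?Q * dx \<psi> = 0" "?P * dy \<phi> + ?Q * dy \<psi> = 0"
    by (simp_all add: pullback_def)
  \<comment> \<open>Cramer's rule; the determinant of the blowup map is the exceptional equation
    \<open>e\<close>.\<close>
  have "?P * (dx \<phi> * dy \<psi> - dy \<phi> * dx \<psi>) =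
      (?P * dx \<phi> + ?Q * dx \<psi>) * dy \<psi> - (?P * dy \<phi> + ?Q * dy \<psi>) * dx \<psi>"
    "?Q * (dx \<phi> * dy \<psi> - dy \<phi> * dx \<psi>) =
      (?P * dy \<phi> + ?Q * dy \<psi>) * dx \<phi> - (?P * dx \<phi> + ?Q * dx \<psi>) * dy \<phi>"
    by (simp_all add: algebra_simps)
  then have "?P * e = 0" "?Q * e = 0"
    unfolding 0 blowup_chart_facts(5)[OF chart] by simp_all
  moreover have "e \<noteq> 0"
    using blowup_chart_facts(4)[OF chart] by auto
  ultimately show False
    using assms by (simp add: subst_blowup_chart_eq_0_iff[OF chart])
qed

text \<open>The equation \<open>e\<close> has positive order at the origin, so its power of exponent
  n + 1 cannot divide a polynomial with a term of degree n.\<close>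

lemma exceptional_power_not_dvd:
  fixes p :: bipoly
  assumes "e = var_x \<or> e = var_y" "p \<noteq> 0"
  shows "\<exists>n. \<not> e ^ n dvd p"
proof -
  obtain n where n: "coeff (polar p) n \<noteq> 0"
    using polar_order_exists[OF assms(2)] by blast
  have "\<not> e ^ Suc n dvd p"
  proof
    assume "e ^ Suc n dvd p"
    then obtain q where "p = e ^ Suc n * q" ..
    moreover obtain z where "polar e = var_y * z"
      using assms(1) by (metis mult.commute mult_1_right polar_gens(2,3))
    ultimately have "polar p = var_y ^ Suc n * (z ^ Suc n * polar q)"
      by (simp only: polar.hom_mult polar.hom_power power_mult_distrib ac_simps)
    then show False
      using n unfolding var_y_power by (simp add: coeff_monom_mult)
  qed
  then show ?thesis ..
qed

lemma strict_transform_exists: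
  assumes "(P, Q) \<noteq> (0, 0)"
  obtains P' Q' where "strict_transform (P, Q) d (P', Q')"
proof -
  obtain \<phi> \<psi> e where chart: "blowup_chart d = (\<phi>, \<psi>, e)"
    by (cases "blowup_chart d") auto
  obtain R S where RS: "pullback \<phi> \<psi> (P, Q) = (R, S)"
    by (cases "pullback \<phi> \<psi> (P, Q)")
  then have "R \<noteq> 0 \<or> S \<noteq> 0"
    using pullback_blowup_chart_nonzero[OF chart assms] by auto
  then have "\<exists>n. \<not> (e ^ n dvd R \<and> e ^ n dvd S)"
    using exceptional_power_not_dvd[OF blowup_chart_facts(4)[OF chart]] by blast
  then obtain k where k: "\<not> (e ^ Suc k dvd R \<and> e ^ Suc k dvd S)" "e ^ k dvd R" "e ^ k dvd S"
    using ex_least_nat_less[of "\<lambda>n. \<not> (e ^ n dvd R \<and> e ^ n dvd S)"] by auto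
  then obtain P' Q' where P': "R = e ^ k * P'" and Q': "S = e ^ k * Q'"
    by (auto elim!: dvdE)
  have "\<not> (e dvd P' \<and> e dvd Q')"
    using k(1) mult_dvd_mono[OF dvd_refl[of "e ^ k"]] by (simp only: P' Q' power_Suc2) blast
  then have "strict_transform (P, Q) d (P', Q')"
    using chart RS P' Q' by (auto simp: strict_transform_def)
  then show ?thesis
    by (rule that)
qed

lemma strict_transform_nonzero: "strict_transform \<omega> d \<eta> \<Longrightarrow> \<eta> \<noteq> (0, 0)"
  by (auto simp: strict_transform_def split: prod.splits)

lemma integral_of_strict_transform:
  assumes "integral_of G1 G2 \<omega>" "strict_transform \<omega> d \<eta>" and chart: "blowup_chart d = (\<phi>, \<psi>, e)"
    and G: "subst \<phi> \<psi> G1 = e ^ n * G1'" "subst \<phi> \<psi> G2 = e ^ n * G2'"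
  shows "integral_of G1' G2' \<eta>"
proof -
  obtain P Q where \<omega>: "\<omega> = (P, Q)"
    by (cases \<omega>)
  obtain k where k: "pullback \<phi> \<psi> \<omega> = (e ^ k * fst \<eta>, e ^ k * snd \<eta>)"
    using assms(2) chart by (auto simp: strict_transform_def)
  have scaled: "integral_of (e ^ n * G1') (e ^ n * G2') (e ^ k * fst \<eta>, e ^ k * snd \<eta>)"
    using integral_of_pullback[of G1 G2 P Q \<phi> \<psi>] assms(1) unfolding G k[unfolded \<omega>] \<omega> by simp
  have "e \<noteq> 0"
    using blowup_chart_facts(4)[OF chart] by auto
  then show ?thesis
    using integral_of_cancel[OF scaled] by (simp add: prod.collapse)
qed

section \<open>Local membership in the ideal of a pencil\<close>

text \<open>Membership in the ideal (G1, G2) of the local ring at the origin: \<open>U\<close> is a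
  unit there. For \<open>F\<close> a power of x and for \<open>F\<close> a power of y it confines
  the common zeros near the origin to the origin itself.\<close>

definition local_mem :: "bipoly \<Rightarrow> bipoly \<Rightarrow> bipoly \<Rightarrow> bool" where
  "local_mem G1 G2 F \<longleftrightarrow> (\<exists>U A B. at_origin U \<noteq> 0 \<and> U * F = A * G1 + B * G2)"

lemma local_mem_commute: "local_mem G1 G2 F \<Longrightarrow> local_mem G2 G1 F"
  unfolding local_mem_def by (metis add.commute)

lemma local_mem_sub: 
  assumes "local_mem G1 G2 F"
  shows "local_mem (G1 - H * G2) G2 F"
proof -
  obtain U A B where "at_origin U \<noteq> 0" "U * F = A * G1 + B * G2"
    using assms by (auto simp: local_mem_def)
  moreover have "A * G1 + B * G2 = A * (G1 - H * G2) + (B + A * H) * G2"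
    by (simp add: algebra_simps)
  ultimately show ?thesis
    unfolding local_mem_def by metis
qed

lemma local_mem_swap_vars:
  "local_mem G1 G2 F \<Longrightarrow> local_mem (swap_vars G1) (swap_vars G2) (swap_vars F)"
  unfolding local_mem_def by (metis at_origin_swap_vars swap_vars.hom_add swap_vars.hom_mult)

text \<open>Pulling back gives a unit times e^M on one side and e^n times a combination of the new
  generators on the other. If n exceeded M, the unit would be divisible by \<open>e\<close>;
  otherwise e^n cancels. This drop by n drives the termination argument.\<close>

lemma local_mem_blowup:
  assumes mem: "local_mem G1 G2 (z ^ M)" and 0: "at_origin \<phi> = 0" "at_origin \<psi> = 0" "at_origin e = 0"
    and "e \<noteq> 0" and z: "subst \<phi> \<psi> z = e"
    and G: "subst \<phi> \<psi> G1 = e ^ n * G1'" "subst \<phi> \<psi> G2 = e ^ n * G2'"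
  shows "n \<le> M" "local_mem G1' G2' (e ^ (M - n))"
proof -
  obtain U A B where U: "at_origin U \<noteq> 0" and "U * z ^ M = A * G1 + B * G2"
    using mem by (auto simp: local_mem_def)
  then have "subst \<phi> \<psi> (U * z ^ M) = subst \<phi> \<psi> (A * G1 + B * G2)"
    by simp
  then have eq: "e ^ M * subst \<phi> \<psi> U = e ^ n * (subst \<phi> \<psi> A * G1' + subst \<phi> \<psi> B * G2')"
    by (simp add: subst.hom_add subst.hom_mult subst.hom_power z G algebra_simps)
  have sU: "at_origin (subst \<phi> \<psi> U) \<noteq> 0"
    using U by (simp add: at_origin_subst 0)
  show "n \<le> M"
  proof (rule ccontr)
    assume "\<not> n \<le> M"
    then have "e ^ n = e ^ M * (e * e ^ (n - M - 1))"
      by (simp flip: power_add power_Suc)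
    then have "e ^ M * subst \<phi> \<psi> U =
        e ^ M * (e * (e ^ (n - M - 1) * (subst \<phi> \<psi> A * G1' + subst \<phi> \<psi> B * G2')))"
      using eq by (simp only: mult.assoc)
    then have "subst \<phi> \<psi> U = e * (e ^ (n - M - 1) * (subst \<phi> \<psi> A * G1' + subst \<phi> \<psi> B * G2'))"
      using \<open>e \<noteq> 0\<close> by simp
    then show False
      using sU 0(3) by (simp add: at_origin.hom_mult)
  qed
  then have "e ^ M = e ^ n * e ^ (M - n)"
    by (simp flip: power_add)
  then have "subst \<phi> \<psi> U * e ^ (M - n) = subst \<phi> \<psi> A * G1' + subst \<phi> \<psi> B * G2'"
    using eq \<open>e \<noteq> 0\<close> by (simp add: mult.assoc) (simp add: mult.commute)
  then show "local_mem G1' G2' (e ^ (M - n))"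
    unfolding local_mem_def using sU by blast
qed

lemma split_along_y: "\<exists>H. G = map_poly (\<lambda>c. [:c:]) (along_y G) + var_x * H"
proof
  have "[:coeff q 0:] + [:0, 1:] * poly_shift 1 q = q" for q :: "complex poly"
    by (intro poly_eqI) (simp add: coeff_pCons coeff_poly_shift split: nat.splits)
  then show "G = map_poly (\<lambda>c. [:c:]) (along_y G) + var_x * map_poly (poly_shift 1) G"
    by (intro poly_eqI[of G])
       (simp add: coeff_map_poly coeff_var_x_mult coeff_along_y poly_shift_0)
qed

text \<open>Write G2 = h(y) + x H. Modulo G2 the polynomial h equals - x H, so h^K is a multiple of
  x^K and lies in the local ideal. As h is a power of y times a local unit, a power of y lies there
  too.\<close>

lemma local_mem_other_axis:
  assumes mem: "local_mem G1 G2 (var_x ^ K)" and "along_y G2 \<noteq> 0"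
  shows "\<exists>L. local_mem G1 G2 (var_y ^ L)"
proof -
  let ?E = "map_poly (\<lambda>c. [:c:]) :: complex poly \<Rightarrow> bipoly"
  interpret const: comm_ring_hom "\<lambda>c :: complex. [:c:]"
    by unfold_locales (simp_all add: one_pCons)
  interpret E: map_poly_comm_ring_hom "\<lambda>c :: complex. [:c:]" ..
  obtain t j where T: "along_y G2 = [:0, 1:] ^ j * t" and t: "coeff t 0 \<noteq> 0"
    using order_decomp[OF assms(2), of 0] poly_eq_0_iff_dvd[of _ "0 :: complex"]
    by (auto simp: poly_0_coeff_0)
  obtain H where H: "G2 = ?E (along_y G2) + var_x * H"
    using split_along_y by blast
  obtain U A B where U: "at_origin U \<noteq> 0" and UAB: "U * var_x ^ K = A * G1 + B * G2"
    using mem by (auto simp: local_mem_def)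
  define S where "S = (\<Sum>i<K. (- (var_x * H)) ^ (K - Suc i) * ?E (along_y G2) ^ i)"
  have "?E (along_y G2) ^ K - (- (var_x * H)) ^ K = (?E (along_y G2) - - (var_x * H)) * S"
    unfolding S_def by (rule power_diff_sumr2)
  also have "?E (along_y G2) - - (var_x * H) = G2"
    using H by simp
  finally have "?E (along_y G2) ^ K = (- H) ^ K * var_x ^ K + S * G2"
    by (simp add: power_mult_distrib[symmetric] algebra_simps)
  then have "U * ?E (along_y G2) ^ K = (- H) ^ K * (U * var_x ^ K) + U * S * G2"
    by (simp only: distrib_left ac_simps)
  then have "U * ?E (along_y G2) ^ K = ((- H) ^ K * A) * G1 + ((- H) ^ K * B + U * S) * G2"
    unfolding UAB by (simp only: distrib_left distrib_right ac_simps)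
  moreover have "?E (along_y G2) = var_y ^ j * ?E t"
  proof -
    have "?E [:0, 1:] = var_y"
      by (simp add: var_y_def Polynomial.map_poly_pCons)
    then show ?thesis
      by (simp only: T E.hom_mult E.hom_power)
  qed
  ultimately have "(U * ?E t ^ K) * var_y ^ (j * K) = ((- H) ^ K * A) * G1 + ((- H) ^ K * B + U * S) * G2"
    by (simp only: power_mult power_mult_distrib) (simp only: ac_simps)
  moreover have "at_origin (U * ?E t ^ K) \<noteq> 0"
  proof -
    have "at_origin (?E t) = coeff t 0"
      by (simp add: at_origin_def poly_0_coeff_0 coeff_map_poly)
    then show ?thesis
      using U t by (simp add: at_origin.hom_mult at_origin.hom_power)
  qed
  ultimately show ?thesis
    unfolding local_mem_def by blast
qed

lemma local_mem_other_axis':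
  assumes "local_mem G1 G2 (var_y ^ K)" and "coeff G2 0 \<noteq> 0"
  shows "\<exists>L. local_mem G1 G2 (var_x ^ L)"
proof -
  have "along_y (swap_vars G2) = coeff G2 0"
    by (intro poly_eqI) (simp add: coeff_along_y coeff_swap_vars)
  moreover have "local_mem (swap_vars G1) (swap_vars G2) (var_x ^ K)"
    using local_mem_swap_vars[OF assms(1)] by (simp add: swap_vars.hom_power)
  ultimately obtain L where "local_mem (swap_vars G1) (swap_vars G2) (var_y ^ L)"
    using local_mem_other_axis assms(2) by metis
  then have "local_mem G1 G2 (var_x ^ L)"
    using local_mem_swap_vars[of "swap_vars G1" "swap_vars G2" "var_y ^ L"] by (simp add: swap_vars.hom_power)
  then show ?thesis ..
qed

section \<open>Base points of pencils are dicritical\<close>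

text \<open>Powers of both variables are required because either one may become the equation of the
  next exceptional divisor.\<close>

definition base_point :: "bipoly \<Rightarrow> bipoly \<Rightarrow> form \<Rightarrow> bool" where
  "base_point G1 G2 \<omega> \<longleftrightarrow> at_origin G1 = 0 \<and> at_origin G2 = 0 \<and>
     (\<exists>M. local_mem G1 G2 (var_x ^ M)) \<and> (\<exists>M. local_mem G1 G2 (var_y ^ M)) \<and>
     \<omega> \<noteq> (0, 0) \<and> integral_of G1 G2 \<omega>"

lemma base_point_power:
  assumes "base_point G1 G2 \<omega>"
  obtains M where "local_mem G1 G2 ((if b then var_x else var_y) ^ M)"
  using assms by (cases b) (auto simp: base_point_def)

lemma base_point_commute: "base_point G1 G2 \<omega> \<Longrightarrow> base_point G2 G1 \<omega>"
  unfolding base_point_def using local_mem_commute integral_of_swap by blast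

lemma base_point_sub: "base_point G1 G2 \<omega> \<Longrightarrow> base_point (G1 - cst c * G2) G2 \<omega>"
  unfolding base_point_def using local_mem_sub integral_of_sub
  by (simp add: at_origin.hom_minus at_origin.hom_mult) blast

text \<open>The assumptions \<open>restr\<close> say that G2' does not contain the exceptional
  divisor. This is what recovers a power of the other variable, whose exponent is not
  controlled.\<close>

lemma base_point_strict_transform:
  assumes bp: "base_point G1 G2 \<omega>" and chart: "blowup_chart d = (\<phi>, \<psi>, e)"
    and G: "subst \<phi> \<psi> G1 = e ^ n * G1'" "subst \<phi> \<psi> G2 = e ^ n * G2'"
    and 0: "at_origin G1' = 0" "at_origin G2' = 0"
    and restr: "e = var_x \<Longrightarrow> along_y G2' \<noteq> 0" "e = var_y \<Longrightarrow> coeff G2' 0 \<noteq> 0"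
    and mem: "local_mem G1 G2 (e ^ M)" and "n \<noteq> 0"
  obtains \<omega>' M' where "strict_transform \<omega> d \<omega>'" "base_point G1' G2' \<omega>'"
    "local_mem G1' G2' (e ^ M')" "M' < M"
proof -
  note facts = blowup_chart_facts[OF chart]
  have e: "e \<noteq> 0" "subst \<phi> \<psi> e = e"
    using chart by (cases d; auto)+
  note mem' = local_mem_blowup[OF mem facts(1-3) e G]
  obtain \<omega>' where st: "strict_transform \<omega> d \<omega>'"
    using strict_transform_exists[of "fst \<omega>" "snd \<omega>" d] bp by (metis base_point_def prod.collapse)
  have "(\<exists>M. local_mem G1' G2' (var_x ^ M)) \<and> (\<exists>M. local_mem G1' G2' (var_y ^ M))"
    using facts(4) mem'(2) local_mem_other_axis local_mem_other_axis' restr by metis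
  then have "base_point G1' G2' \<omega>'"
    using bp 0 strict_transform_nonzero[OF st] integral_of_strict_transform[OF _ st chart G]
    by (simp add: base_point_def)
  moreover have "M - n < M"
    using mem'(1) \<open>n \<noteq> 0\<close> by simp
  ultimately show ?thesis
    using that st mem'(2) by blast
qed

text \<open>The inductive definition adds blowups at the top of the tower; the induction on base
  points needs to add one at the bottom.\<close>

lemma config_over_strict_transform:
  assumes "ordinary_singularity \<omega>" "strict_transform \<omega> d \<omega>'" "config_over \<omega>' \<eta>"
  shows "config_over \<omega> \<eta>"
  using assms(3)
proof induction
  case base
  then show ?case
    using assms config_over.intros by blast
next
  case (blowup \<eta> d \<eta>')
  then show ?case
    using config_over.blowup by blast
qed

text \<open>
  When the two initial forms are proportional, subtracting a multiple makes \<open>G1\<close> vanish to higher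
  order than \<open>G2\<close>; the exceptional divisor then meets the strict transform of \<open>G2\<close> in a new base
  point. The order \<open>n\<close> of \<open>G2\<close> does not increase. As long as it is constant, \<open>G2\<close> stays transversal
  to the last exceptional divisor, so that its coefficient of \<open>y ^ n\<close> stays nonzero once it is
  nonzero; the exponent \<open>M\<close> of the power of \<open>x\<close> (or of \<open>y\<close>, as long as that coefficient is zero)
  in the ideal of the pencil decreases.
\<close>

lemma base_point_dicritical_step:
  fixes n f M :: nat
  assumes "base_point G1 G2 \<omega>" "\<And>i. i < n \<Longrightarrow> coeff (polar G1) i = 0" "\<And>i. i < n \<Longrightarrow> coeff (polar G2) i = 0"
    and "coeff (polar G2) n \<noteq> 0" "f = (if coeff (coeff (polar G2) n) n = 0 then 1 else 0)"
    and "local_mem G1 G2 ((if f = 0 then var_x else var_y) ^ M)"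
  shows "ordinary_singularity \<omega> \<and> dicritical \<omega>"
  using assms
proof (induction "(n, f, M)" arbitrary: n f M G1 G2 \<omega>
    rule: wf_induct_rule[OF wf_lex_prod[OF wf_less_than wf_lex_prod[OF wf_less_than wf_less_than]]])
  case 1
  note bp = 1(2) and low = 1(3,4) and k = 1(5) and f = 1(6) and mem = 1(7)
  obtain P Q where \<omega>: "\<omega> = (P, Q)"
    by (cases \<omega>)
  have nz: "(P, Q) \<noteq> (0, 0)" and int: "integral_of G1 G2 (P, Q)"
    using bp by (simp_all add: base_point_def \<omega>)
  \<comment> \<open>The induction hypothesis for the new pencil, whose generator of least order must
    come second. If that order drops below n, the generators may have to be exchanged and any
    exponent will do; only for an unchanged order do the flag and the exponent have to
    decrease.\<close>
  have IH: "ordinary_singularity \<omega>' \<and> dicritical \<omega>'"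
    if bp': "base_point H1 H2 \<omega>'" and ord: "\<exists>i\<le>n. coeff (polar H2) i \<noteq> 0"
      and less: "(\<And>i. i < n \<Longrightarrow> coeff (polar H2) i = 0) \<Longrightarrow>
        coeff (coeff (polar H2) n) n = 0 \<Longrightarrow> f = 1 \<and> (\<exists>M'<M. local_mem H1 H2 (var_y ^ M'))"
      and less': "(\<And>i. i < n \<Longrightarrow> coeff (polar H2) i = 0) \<Longrightarrow>
        coeff (coeff (polar H2) n) n \<noteq> 0 \<Longrightarrow> f = 0 \<Longrightarrow> \<exists>M'<M. local_mem H1 H2 (var_x ^ M')"
    for H1 H2 \<omega>'
  proof -
    define m where "m = (LEAST m. coeff (polar H1) m \<noteq> 0 \<or> coeff (polar H2) m \<noteq> 0)"
    have "coeff (polar H1) m \<noteq> 0 \<or> coeff (polar H2) m \<noteq> 0"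
      unfolding m_def by (rule LeastI_ex) (use ord in blast)
    moreover have "m \<le> n"
    proof -
      obtain i where "i \<le> n" "coeff (polar H2) i \<noteq> 0"
        using ord by blast
      then show ?thesis
        using Least_le[of "\<lambda>m. coeff (polar H1) m \<noteq> 0 \<or> coeff (polar H2) m \<noteq> 0" i]
        unfolding m_def by simp
    qed
    moreover have low': "coeff (polar H1) i = 0" "coeff (polar H2) i = 0" if "i < m" for i
      using not_less_Least[of i "\<lambda>m. coeff (polar H1) m \<noteq> 0 \<or> coeff (polar H2) m \<noteq> 0"] that
      by (auto simp: m_def)
    ultimately consider "m < n" "coeff (polar H1) m \<noteq> 0" | "m < n" "coeff (polar H2) m \<noteq> 0" | "m = n"
      by linarith
    then show ?thesis
    proof cases
      case 1
      define g :: nat where "g = (if coeff (coeff (polar H1) m) m = 0 then 1 else 0)"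
      obtain M' where "local_mem H2 H1 ((if g = 0 then var_x else var_y) ^ M')"
        using base_point_power[OF base_point_commute[OF bp']] .
      then show ?thesis
        using "1.hyps"[of m g M' H2 H1 \<omega>'] base_point_commute[OF bp'] low' 1 g_def by auto
    next
      case 2
      define g :: nat where "g = (if coeff (coeff (polar H2) m) m = 0 then 1 else 0)"
      obtain M' where "local_mem H1 H2 ((if g = 0 then var_x else var_y) ^ M')"
        using base_point_power[OF bp'] .
      then show ?thesis
        using "1.hyps"[of m g M' H1 H2 \<omega>'] bp' low' 2 g_def by auto
    next
      case 3
      then have low'': "coeff (polar H1) i = 0" "coeff (polar H2) i = 0" if "i < n" for i
        using low' that by auto
      have Hn: "coeff (polar H2) n \<noteq> 0"
        using ord low''(2) by (metis le_neq_implies_less)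
      define g :: nat where "g = (if coeff (coeff (polar H2) n) n = 0 then 1 else 0)"
      have "\<exists>M'. local_mem H1 H2 ((if g = 0 then var_x else var_y) ^ M') \<and> (g < f \<or> g = f \<and> M' < M)"
      proof (cases "coeff (coeff (polar H2) n) n = 0")
        case True
        then show ?thesis
          using less[OF low''(2)] by (auto simp: g_def)
      next
        case False
        moreover have "\<exists>M'. local_mem H1 H2 (var_x ^ M')"
          using bp' by (simp add: base_point_def)
        ultimately show ?thesis
          using less'[OF low''(2)] by (cases "f = 0") (auto simp: g_def)
      qed
      then obtain M' where "local_mem H1 H2 ((if g = 0 then var_x else var_y) ^ M')" "g < f \<or> g = f \<and> M' < M"
        by blast
      then show ?thesis
        using "1.hyps"[of n g M' H1 H2 \<omega>'] bp' low'' Hn g_def by auto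
    qed
  qed
  show ?case
  proof (cases "pderiv (coeff (polar G1) n) * coeff (polar G2) n = coeff (polar G1) n * pderiv (coeff (polar G2) n)")
    case False
    then have "terminal_dicritical \<omega>"
      unfolding \<omega> by (intro terminal_dicritical_if_initial_forms_independent[OF int nz low]) auto
    then show ?thesis
      using terminal_dicritical_ordinary[OF nz] config_over.base unfolding \<omega> dicritical_def by blast
  next
    case True
    then obtain c where c: "coeff (polar G1) n = Polynomial.smult c (coeff (polar G2) n)"
      using proportional_if_wronskian_0 k by blast
    define H where "H = G1 - cst c * G2"
    have bpH: "base_point H G2 \<omega>"
      unfolding H_def by (rule base_point_sub[OF bp])
    have memH: "local_mem H G2 ((if f = 0 then var_x else var_y) ^ M)"
      unfolding H_def by (rule local_mem_sub[OF mem])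
    have lowH: "coeff (polar H) i = 0" if "i \<le> n" for i
      using that low[of i] c by (cases "i = n") (simp_all add: H_def polar.hom_minus polar.hom_mult)
    have "n \<noteq> 0"
    proof
      assume "n = 0"
      then show False
        using k bp by (simp add: coeff_polar_0 base_point_def)
    qed
    have "\<exists>d \<omega>'. strict_transform \<omega> d \<omega>' \<and> ordinary_singularity \<omega>' \<and> dicritical \<omega>'"
    proof (cases "f = 0")
      case flag: True
      let ?k = "coeff (polar G2) n"
      have kn: "coeff ?k n \<noteq> 0"
        using f flag by (auto split: if_splits)
      then have "degree ?k \<ge> n"
        by (rule le_degree)
      moreover have "degree ?k \<le> n"
        by (rule degree_le) (simp add: coeff_polar)
      ultimately have deg: "degree ?k = n"
        by simp
      \<comment> \<open>The nonzero coefficient of y^n gives the initial form full degree n in the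
        slope, and n is positive. A root c is a tangent direction of G2, hence a point where G'
        vanishes.\<close>
      obtain c where root: "poly ?k c = 0"
        using fundamental_theorem_of_algebra_alt[of ?k] deg \<open>n \<noteq> 0\<close> by (metis degree_pCons_0)
      obtain H' where H': "subst var_x (var_x * (var_y + cst c)) H = var_x ^ n * H'"
          "along_y H' = pcompose (coeff (polar H) n) [:c, 1:]"
        using slope_factor[of n H c] lowH by auto
      obtain G' where G': "subst var_x (var_x * (var_y + cst c)) G2 = var_x ^ n * G'"
          "along_y G' = pcompose ?k [:c, 1:]"
        using slope_factor[of n G2 c] low by auto
      have degG': "degree (along_y G') = n"
        by (simp add: G'(2) deg)
      obtain \<omega>' M' where st: "strict_transform \<omega> (Slope c) \<omega>'" and bp': "base_point H' G' \<omega>'"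
        and mem': "local_mem H' G' (var_x ^ M')" "M' < M"
      proof (rule base_point_strict_transform[OF bpH _ H'(1) G'(1)])
        show "at_origin H' = 0" "at_origin G' = 0"
          using lowH[of n] root
          by (simp_all add: coeff_0_along_y[symmetric] H'(2) G'(2) poly_0_coeff_0[symmetric] poly_pcompose)
        show "along_y G' \<noteq> 0"
          using degG' \<open>n \<noteq> 0\<close> by auto
        show "coeff G' 0 \<noteq> 0" if "(var_x :: bipoly) = var_y"
          using arg_cong[OF that, of dx] by simp
        show "local_mem H G2 (var_x ^ M)"
          using memH flag by simp
      qed (use \<open>n \<noteq> 0\<close> in auto)
      \<comment> \<open>Translating the slope keeps the degree n on the exceptional divisor, so y^n
        still occurs in G'. This bounds the order by n and keeps the flag at 0.\<close>
      have lead: "coeff (coeff (polar G') n) n \<noteq> 0"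
      proof -
        have "coeff (along_y G') n \<noteq> 0"
          using degG' \<open>n \<noteq> 0\<close> by (metis degree_0 leading_coeff_0_iff)
        then show ?thesis
          by (simp add: coeff_polar coeff_along_y)
      qed
      then have "\<exists>i\<le>n. coeff (polar G') i \<noteq> 0"
        by (intro exI[of _ n]) auto
      then have "ordinary_singularity \<omega>' \<and> dicritical \<omega>'"
        using IH[OF bp'] lead mem' by blast
      then show ?thesis
        using st by blast
    next
      \<comment> \<open>Without a term y^n the initial form of G2 is divisible by x, so the vertical
        direction is tangent and G' vanishes at the origin of that chart.\<close>
      case flag: False
      then have f1: "f = 1" and kn: "coeff (coeff (polar G2) n) n = 0"
        using f by (auto split: if_splits)
      obtain H' where H': "subst (var_x * var_y) var_y H = var_y ^ n * H'"
          "\<And>j. coeff (coeff H' 0) j = (if j \<le> n then coeff (coeff (polar H) n) (n - j) else 0)"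
        using vertical_factor[of n H] lowH by auto
      obtain G' where G': "subst (var_x * var_y) var_y G2 = var_y ^ n * G'"
          "\<And>j. coeff (coeff G' 0) j = (if j \<le> n then coeff (coeff (polar G2) n) (n - j) else 0)"
        using vertical_factor[of n G2] low by auto
      obtain j where "coeff (coeff (polar G2) n) j \<noteq> 0"
        using k leading_coeff_0_iff by blast
      moreover from this have "j \<le> n"
        using coeff_polar[of G2 n j] by (auto split: if_splits)
      ultimately have j: "coeff (coeff G' 0) (n - j) \<noteq> 0"
        by (simp add: G'(2))
      obtain \<omega>' M' where st: "strict_transform \<omega> Vertical \<omega>'" and bp': "base_point H' G' \<omega>'"
        and mem': "local_mem H' G' (var_y ^ M')" "M' < M"
      proof (rule base_point_strict_transform[OF bpH _ H'(1) G'(1)])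
        show "at_origin H' = 0" "at_origin G' = 0"
          using lowH[of n] kn by (simp_all add: at_origin_def poly_0_coeff_0 H'(2) G'(2))
        show "coeff G' 0 \<noteq> 0"
          using j by auto
        show "along_y G' \<noteq> 0" if "(var_y :: bipoly) = var_x"
          using arg_cong[OF that, of dx] by simp
        show "local_mem H G2 (var_y ^ M)"
          using memH flag by simp
      qed (use \<open>n \<noteq> 0\<close> in auto)
      have "coeff (coeff (polar G') (n - j)) 0 \<noteq> 0"
        using j by (simp add: coeff_polar)
      then have "\<exists>i\<le>n. coeff (polar G') i \<noteq> 0"
        by (intro exI[of _ "n - j"]) auto
      \<comment> \<open>If the order stays n, either the flag drops to 0 or the exponent of y
        decreases.\<close>
      then have "ordinary_singularity \<omega>' \<and> dicritical \<omega>'"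
        using IH[OF bp'] f1 mem' by auto
      then show ?thesis
        using st by blast
    qed
    then obtain d \<omega>' where st: "strict_transform \<omega> d \<omega>'"
      and \<omega>': "ordinary_singularity \<omega>'" "dicritical \<omega>'"
      by blast
    have "ordinary_singularity \<omega>"
      using not_ordinary_strict_transform[OF nz _ st[unfolded \<omega>]] \<omega>'(1) \<omega> by blast
    then show ?thesis
      using config_over_strict_transform[OF _ st] \<omega>'(2) unfolding dicritical_def by blast
  qed
qed

theorem base_point_dicritical:
  assumes bp: "base_point G1 G2 \<omega>"
  shows "dicritical \<omega>"
proof -
  have *: "dicritical \<omega>"
    if bp: "base_point H1 H2 \<omega>" and low: "\<And>i. i < n \<Longrightarrow> coeff (polar H1) i = 0 \<and> coeff (polar H2) i = 0"
      and n: "coeff (polar H2) n \<noteq> 0" for H1 H2 n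
  proof -
    define f :: nat where "f = (if coeff (coeff (polar H2) n) n = 0 then 1 else 0)"
    obtain M where "local_mem H1 H2 ((if f = 0 then var_x else var_y) ^ M)"
      using base_point_power[OF bp] .
    then show ?thesis
      using base_point_dicritical_step[OF bp _ _ n f_def] low by blast
  qed
  define n where "n = (LEAST n. coeff (polar G1) n \<noteq> 0 \<or> coeff (polar G2) n \<noteq> 0)"
  have "\<exists>n. coeff (polar G1) n \<noteq> 0 \<or> coeff (polar G2) n \<noteq> 0"
  proof (rule ccontr)
    assume "\<not> ?thesis"
    then have "polar G1 = 0" "polar G2 = 0"
      by (auto intro: poly_eqI)
    then have "G1 = 0" "G2 = 0"
      by (simp_all add: polar_eq_0_iff)
    moreover obtain M where "local_mem G1 G2 (var_x ^ M)"
      using bp by (auto simp: base_point_def)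
    ultimately obtain U where "at_origin U \<noteq> 0" "U * var_x ^ M = 0"
      by (auto simp: local_mem_def)
    then show False
      by (auto simp: at_origin.hom_zero)
  qed
  then have "coeff (polar G1) n \<noteq> 0 \<or> coeff (polar G2) n \<noteq> 0"
    unfolding n_def by (rule LeastI_ex)
  moreover have "coeff (polar G1) i = 0 \<and> coeff (polar G2) i = 0" if "i < n" for i
    using not_less_Least[of i "\<lambda>n. coeff (polar G1) n \<noteq> 0 \<or> coeff (polar G2) n \<noteq> 0"] that
    by (auto simp: n_def)
  ultimately show ?thesis
    using *[OF bp, of n] *[OF base_point_commute[OF bp], of n] by blast
qed

section \<open>Points where the pencil has no base point\<close>

lemma regular_integral_not_dicritical:
  assumes "integral_of G1 G2 \<omega>" "\<omega> \<noteq> (0, 0)" "at_origin G2 \<noteq> 0" "\<And>c. G1 \<noteq> cst c * G2"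
  shows "\<not> dicritical \<omega>"
proof -
  \<comment> \<open>The invariant along the whole configuration: a nonconstant integral whose
    denominator is a local unit. Its pullback is used as it stands, with no exceptional factor
    removed.\<close>
  have "\<eta> \<noteq> (0, 0) \<and> (\<exists>H1 H2. integral_of H1 H2 \<eta> \<and> at_origin H2 \<noteq> 0 \<and> (\<forall>c. H1 \<noteq> cst c * H2))"
    if "config_over \<omega> \<eta>" for \<eta>
    using that
  proof induction
    case base
    then show ?case
      using assms by blast
  next
    case (blowup \<eta> d \<eta>')
    then obtain H1 H2 where int: "integral_of H1 H2 \<eta>" and H2: "at_origin H2 \<noteq> 0"
      and nonconst: "\<And>c. H1 \<noteq> cst c * H2"
      by blast
    obtain \<phi> \<psi> e where chart: "blowup_chart d = (\<phi>, \<psi>, e)"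
      by (cases "blowup_chart d") auto
    have "integral_of (subst \<phi> \<psi> H1) (subst \<phi> \<psi> H2) \<eta>'"
      by (rule integral_of_strict_transform[OF int \<open>strict_transform \<eta> d \<eta>'\<close> chart, of 0]) simp_all
    moreover have "at_origin (subst \<phi> \<psi> H2) \<noteq> 0"
      using H2 blowup_chart_facts(1,2)[OF chart] by (simp add: at_origin_subst)
    moreover have "subst \<phi> \<psi> H1 \<noteq> cst c * subst \<phi> \<psi> H2" for c
    proof
      assume "subst \<phi> \<psi> H1 = cst c * subst \<phi> \<psi> H2"
      then have "subst \<phi> \<psi> (H1 - cst c * H2) = 0"
        by (simp add: subst.hom_minus subst.hom_mult)
      then show False
        using nonconst[of c] subst_blowup_chart_eq_0_iff[OF chart] by simp
    qed
    ultimately show ?case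
      using strict_transform_nonzero[OF \<open>strict_transform \<eta> d \<eta>'\<close>] by blast
  qed
  then show ?thesis
    unfolding dicritical_def using not_terminal_dicritical_if_integral_regular by (metis prod.collapse)
qed

lemma regular_pencil_not_dicritical:
  assumes "integral_of G1 G2 \<omega>" "\<omega> \<noteq> (0, 0)" "at_origin G1 \<noteq> 0 \<or> at_origin G2 \<noteq> 0"
    and "\<And>c. G1 \<noteq> cst c * G2" "G2 \<noteq> 0"
  shows "\<not> dicritical \<omega>"
proof (cases "at_origin G2 = 0")
  case True
  have "G2 \<noteq> cst c * G1" for c
  proof
    assume eq: "G2 = cst c * G1"
    then have "c \<noteq> 0"
      using \<open>G2 \<noteq> 0\<close> by (auto simp: cst.hom_zero)
    then have "cst (1 / c) * G2 = G1"
      by (simp add: eq mult.assoc[symmetric] cst.hom_mult[symmetric] cst.hom_one)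
    then show False
      using assms(4) by metis
  qed
  then show ?thesis
    using assms True by (intro regular_integral_not_dicritical[OF integral_of_swap]) auto
next
  case False
  then show ?thesis
    using assms by (intro regular_integral_not_dicritical) auto
qed

section \<open>Elimination\<close>

text \<open>Take g of least y-degree in the ideal. Pseudo-remainders by g stay in the ideal and
  therefore vanish, so by Gauss's lemma the primitive part of g divides f1 and f2. It is then a
  unit, and g has degree 0 in y.\<close>

lemma elimination_ideal_nonzero:
  fixes f1 f2 :: bipoly
  assumes "coprime f1 f2"
  shows "\<exists>A B r. r \<noteq> 0 \<and> A * f1 + B * f2 = [:r:]"
proof -
  define I where "I = {A * f1 + B * f2 |A B. True}"
  have I_lin: "u * g + v * h \<in> I" if mem: "g \<in> I" "h \<in> I" for u v g h
  proof -
    obtain A B A' B' where "g = A * f1 + B * f2" "h = A' * f1 + B' * f2"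
      using mem unfolding I_def by blast
    then have "u * g + v * h = (u * A + v * A') * f1 + (u * B + v * B') * f2"
      by (simp add: algebra_simps)
    then show ?thesis
      unfolding I_def by blast
  qed
  have f: "f1 \<in> I" "f2 \<in> I"
    unfolding I_def by (force intro: exI[of _ 1] exI[of _ 0])+
  have "f1 \<noteq> 0 \<or> f2 \<noteq> 0"
    using assms by auto
  then have "\<exists>g. g \<in> I \<and> g \<noteq> 0"
    using f by blast
  then obtain g where g: "g \<in> I" "g \<noteq> 0" and min: "\<And>h. h \<in> I \<Longrightarrow> h \<noteq> 0 \<Longrightarrow> degree g \<le> degree h"
    using ex_has_least_nat[of "\<lambda>g. g \<in> I \<and> g \<noteq> 0" _ degree] by blast
  have "primitive_part g dvd h" if "h \<in> I" for h
  proof -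
    obtain a q where a: "a \<noteq> 0" "Polynomial.smult a h = g * q + pseudo_mod h g"
      and deg: "pseudo_mod h g = 0 \<or> degree (pseudo_mod h g) < degree g"
      using pseudo_mod[OF g(2), of h] by blast
    have "pseudo_mod h g = [:a:] * h + (- q) * g"
      using a(2) by (simp add: algebra_simps)
    then have "pseudo_mod h g \<in> I"
      using I_lin[OF that g(1), of "[:a:]" "- q"] by (simp only:)
    then have "pseudo_mod h g = 0"
      using deg min by (meson leD)
    then have "Polynomial.smult a h = primitive_part g * Polynomial.smult (content g) q"
      using a(2) content_times_primitive_part[of g] by (metis add.right_neutral mult_smult_left mult_smult_right)
    then have "fract_poly (primitive_part g) dvd Polynomial.smult (to_fract a) (fract_poly h)"
      by (metis dvd_triv_left fract_poly_dvd fract_poly_smult)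
    then have "fract_poly (primitive_part g) dvd fract_poly h"
      using a(1) by (simp add: dvd_smult_iff)
    then show ?thesis
      by (rule fract_poly_dvdD) (use g(2) in simp)
  qed
  then have "primitive_part g dvd 1"
    using assms f by (meson coprime_common_divisor)
  then have "degree g = 0"
    using degree_primitive_part[of g] by (metis poly_dvd_1)
  then obtain r where "g = [:r:]"
    by (rule degree_eq_zeroE)
  moreover obtain A B where "g = A * f1 + B * f2"
    using g(1) unfolding I_def by blast
  ultimately show ?thesis
    using g(2) by (metis pCons_0_0)
qed

section \<open>Derivations of the field of rational functions\<close>

lemma fract_derivation_rules:
  assumes mult: "\<And>p q. D (p * q) = D p * q + p * D q" and add: "\<And>p q. D (p + q) = D p + D q"
  shows "fract_derivation D (f + g) = fract_derivation D f + fract_derivation D g"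
    and "fract_derivation D (f * g) = fract_derivation D f * g + f * fract_derivation D g"
    and "fract_derivation D (rat p) = rat (D p)"
proof -
  obtain f1 f2 where f: "f = Fraction_Field.Fract f1 f2" "f2 \<noteq> 0"
    by (cases f)
  obtain g1 g2 where g: "g = Fraction_Field.Fract g1 g2" "g2 \<noteq> 0"
    by (cases g)
  note D = fract_derivation_Fract[OF mult]
  have "D 1 = 0"
    using mult[of 1 1] by simp
  then show "fract_derivation D (rat p) = rat (D p)"
    by (simp add: rat_def D)
  show "fract_derivation D (f + g) = fract_derivation D f + fract_derivation D g"
    using f g by (simp add: D eq_fract mult add algebra_simps)
  show "fract_derivation D (f * g) = fract_derivation D f * g + f * fract_derivation D g"
    using f g by (simp add: D eq_fract mult add algebra_simps)
qed

lemmas rdx_rules = fract_derivation_rules[of dx, OF dx_mult dx_add, folded rdx_def]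
lemmas rdy_rules = fract_derivation_rules[of dy, OF dy_mult dy_add, folded rdy_def]

abbreviation rsubst :: "birat \<Rightarrow> birat \<Rightarrow> bipoly \<Rightarrow> birat" where
  "rsubst u v p \<equiv> bieval rcst p u v"

interpretation rsubst: comm_ring_hom "rsubst u v" for u v
  by (rule bieval_hom) (rule rcst.comm_ring_hom_axioms)

lemmas rsubst_gens [simp] = bieval_gens[OF rcst.comm_ring_hom_axioms]

lemma rat_chain_rule:
  assumes D_add: "\<And>f g. D (f + g) = D f + D g" and D_mult: "\<And>f g. D (f * g) = D f * g + f * D g"
    and D_cst: "\<And>c. D (rcst c) = 0"
  shows "D (rsubst u v p) = rsubst u v (dx p) * D u + rsubst u v (dy p) * D v"
  by (induction p rule: bipoly_induct)
     (simp_all add: D_mult D_add D_cst dx_add dy_add dx_mult dy_mult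
       rsubst.hom_add rsubst.hom_mult algebra_simps)

lemma rdx_rcst: "rdx (rcst c) = 0" and rdy_rcst: "rdy (rcst c) = 0"
  by (simp_all add: rcst_def rdx_rules rdy_rules rat.hom_zero)

lemmas rdx_rsubst = rat_chain_rule[of rdx, OF rdx_rules(1,2) rdx_rcst]
lemmas rdy_rsubst = rat_chain_rule[of rdy, OF rdy_rules(1,2) rdy_rcst]

lemma rat_integral_of_pullback:
  assumes int: "integral_of f1 f2 (P, Q)" and RS: "rat_pullback \<phi> \<psi> (P, Q) = (R, S)"
    and G: "rat G1 = h * rsubst \<phi> \<psi> f1" "rat G2 = h * rsubst \<phi> \<psi> f2"
    and \<omega>: "rat (fst \<omega>) = r * R" "rat (snd \<omega>) = r * S"
  shows "integral_of G1 G2 \<omega>"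
proof -
  let ?s = "rsubst \<phi> \<psi>"
  have rel: "?s (wedge dx f1 f2) * ?s Q = ?s (wedge dy f1 f2) * ?s P"
    using int by (simp add: integral_of_def flip: rsubst.hom_mult)
  \<comment> \<open>The derivatives of the common factor \<open>h\<close> cancel in the wedge,
    leaving only its square.\<close>
  have W: "rat (wedge D G1 G2) = h * h * (?s (wedge dx f1 f2) * E \<phi> + ?s (wedge dy f1 f2) * E \<psi>)"
    if "\<And>p. E (rat p) = rat (D p)" "\<And>f g. E (f * g) = E f * g + f * E g"
      "\<And>p. E (?s p) = ?s (dx p) * E \<phi> + ?s (dy p) * E \<psi>" for D E
  proof -
    have "rat (wedge D G1 G2) = E (rat G1) * rat G2 - rat G1 * E (rat G2)"
      by (simp add: wedge_def rat.hom_minus rat.hom_mult that(1))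
    then show ?thesis
      unfolding G that(2,3) by (simp add: wedge_def rsubst.hom_minus rsubst.hom_mult algebra_simps)
  qed
  have "rat (wedge dx G1 G2) * S - rat (wedge dy G1 G2) * R =
      h * h * (rdx \<phi> * rdy \<psi> - rdy \<phi> * rdx \<psi>) *
        (?s (wedge dx f1 f2) * ?s Q - ?s (wedge dy f1 f2) * ?s P)"
    using RS unfolding W[of rdx dx, OF rdx_rules(3,2) rdx_rsubst] W[of rdy dy, OF rdy_rules(3,2) rdy_rsubst]
    by (auto simp: rat_pullback_def algebra_simps)
  also have "\<dots> = 0"
    by (simp add: rel)
  finally have "rat (wedge dx G1 G2) * S = rat (wedge dy G1 G2) * R"
    by simp
  then have "rat (wedge dx G1 G2) * (r * S) = rat (wedge dy G1 G2) * (r * R)"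
    by (simp add: algebra_simps)
  then have "rat (wedge dx G1 G2 * snd \<omega>) = rat (wedge dy G1 G2 * fst \<omega>)"
    by (simp add: rat.hom_mult \<omega>)
  then show ?thesis
    by (cases \<omega>) (simp add: integral_of_def rat.eq_iff del: rat.hom_mult)
qed

lemma coprime_form_exists:
  fixes R S :: birat
  assumes "(R, S) \<noteq> (0, 0)"
  shows "\<exists>P Q r. coprime P Q \<and> r \<noteq> 0 \<and> rat P = r * R \<and> rat Q = r * S"
proof -
  obtain p1 q1 where R: "R = Fraction_Field.Fract p1 q1" "q1 \<noteq> 0"
    by (cases R)
  obtain p2 q2 where S: "S = Fraction_Field.Fract p2 q2" "q2 \<noteq> 0"
    by (cases S)
  define g where "g = gcd (p1 * q2) (p2 * q1)"
  have "p1 * q2 \<noteq> 0 \<or> p2 * q1 \<noteq> 0"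
    using assms R S by (auto simp: Zero_fract_def eq_fract)
  then have "g \<noteq> 0"
    by (simp add: g_def)
  obtain P Q where PQ: "p1 * q2 = P * g" "p2 * q1 = Q * g" "coprime P Q"
    using gcd_coprime_exists[of "p1 * q2" "p2 * q1"] \<open>g \<noteq> 0\<close> unfolding g_def by blast
  have "rat P = Fraction_Field.Fract (q1 * q2) g * R" "rat Q = Fraction_Field.Fract (q1 * q2) g * S"
    using R S PQ(1,2) \<open>g \<noteq> 0\<close> by (simp_all add: rat_def eq_fract mult_ac)
  moreover have "Fraction_Field.Fract (q1 * q2) g \<noteq> 0"
    using R S \<open>g \<noteq> 0\<close> by (simp add: Zero_fract_def eq_fract)
  ultimately show ?thesis
    using PQ(3) by blast
qed

section \<open>The chart at infinity\<close>

lemma monom_monom: "monom (monom (c :: complex) i) j = cst c * var_x ^ i * var_y ^ j"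
  unfolding var_x_power var_y_power by (simp add: cst_def smult_monom)

text \<open>Multiplying by s^N clears the pole along s = 0 and sends x^i y^j to s^(N + \<delta> j -
  i) t^j. Coefficients are only renumbered, and truncated subtraction is harmless by
  \<open>supp\<close>.\<close>

lemma chart_transform:
  fixes \<delta> N :: nat
  defines "x \<equiv> rat var_x" and "y \<equiv> rat var_y"
  assumes supp: "\<And>i j. coeff (coeff p j) i \<noteq> 0 \<Longrightarrow> i \<le> N + \<delta> * j"
  shows "\<exists>G. rat G = x ^ N * rsubst (inverse x) (x ^ \<delta> * y) p \<and>
    (\<forall>j k. coeff (coeff G j) k = (if k \<le> N + \<delta> * j then coeff (coeff p j) (N + \<delta> * j - k) else 0))"
proof (intro exI conjI allI)
  define M where "M j = N + \<delta> * j" for j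
  define G where "G = (\<Sum>j\<le>degree p. monom (\<Sum>i\<le>M j. monom (coeff (coeff p j) i) (M j - i)) j)"
  have x: "x \<noteq> 0"
    by (simp add: x_def)
  have "p = (\<Sum>j\<le>degree p. monom (\<Sum>i\<le>M j. monom (coeff (coeff p j) i) i) j)"
  proof (rule poly_eqI)
    fix j
    have inner: "(\<Sum>i\<le>M j. monom (coeff (coeff p j) i) i) = coeff p j"
    proof (rule poly_eqI)
      fix i
      show "coeff (\<Sum>i\<le>M j. monom (coeff (coeff p j) i) i) i = coeff (coeff p j) i"
        using supp[of j i] by (auto simp: coeff_sum M_def)
    qed
    have "coeff (\<Sum>j\<le>degree p. monom (\<Sum>i\<le>M j. monom (coeff (coeff p j) i) i) j) j =
        (\<Sum>k\<le>degree p. if k = j then \<Sum>i\<le>M j. monom (coeff (coeff p j) i) i else 0)"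
      unfolding coeff_sum by (intro sum.cong) auto
    then show "coeff p j = coeff (\<Sum>j\<le>degree p. monom (\<Sum>i\<le>M j. monom (coeff (coeff p j) i) i) j) j"
      by (simp add: inner coeff_eq_0)
  qed
  then have "rsubst (inverse x) (x ^ \<delta> * y) p =
      rsubst (inverse x) (x ^ \<delta> * y) (\<Sum>j\<le>degree p. \<Sum>i\<le>M j. monom (monom (coeff (coeff p j) i) i) j)"
    by (simp add: monom_sum)
  also have "\<dots> = (\<Sum>j\<le>degree p. \<Sum>i\<le>M j. rcst (coeff (coeff p j) i) * inverse x ^ i * (x ^ \<delta> * y) ^ j)"
    by (simp add: rsubst.hom_sum monom_monom rsubst.hom_mult rsubst.hom_power)
  finally have "x ^ N * rsubst (inverse x) (x ^ \<delta> * y) p =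
      (\<Sum>j\<le>degree p. \<Sum>i\<le>M j. x ^ N * (rcst (coeff (coeff p j) i) * inverse x ^ i * (x ^ \<delta> * y) ^ j))"
    by (simp add: sum_distrib_left)
  also have "\<dots> = (\<Sum>j\<le>degree p. \<Sum>i\<le>M j. rat (monom (monom (coeff (coeff p j) i) (M j - i)) j))"
  proof (intro sum.cong refl)
    fix i j assume "i \<in> {..M j}"
    then have "x ^ M j = x ^ i * x ^ (M j - i)"
      by (simp flip: power_add)
    then have "x ^ N * x ^ (\<delta> * j) * inverse x ^ i = x ^ (M j - i)"
      using x by (simp add: M_def power_add field_simps)
    then show "x ^ N * (rcst (coeff (coeff p j) i) * inverse x ^ i * (x ^ \<delta> * y) ^ j) =
        rat (monom (monom (coeff (coeff p j) i) (M j - i)) j)"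
      by (simp add: monom_monom rat.hom_mult rat.hom_power rcst_def power_mult_distrib mult_ac
          flip: x_def y_def power_mult)
  qed
  also have "\<dots> = rat G"
    by (simp add: G_def rat.hom_sum monom_sum)
  finally show "rat G = x ^ N * rsubst (inverse x) (x ^ \<delta> * y) p" ..
  fix j k
  have "coeff G j = (\<Sum>l\<le>degree p. if l = j then \<Sum>i\<le>M j. monom (coeff (coeff p j) i) (M j - i) else 0)"
    unfolding G_def coeff_sum by (intro sum.cong) auto
  then have G: "coeff G j = (\<Sum>i\<le>M j. monom (coeff (coeff p j) i) (M j - i))"
    by (simp add: coeff_eq_0)
  show "coeff (coeff G j) k = (if k \<le> N + \<delta> * j then coeff (coeff p j) (N + \<delta> * j - k) else 0)"
  proof (cases "k \<le> M j")
    case True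
    then have "coeff (coeff G j) k = (\<Sum>i\<le>M j. if i = M j - k then coeff (coeff p j) (M j - k) else 0)"
      unfolding G coeff_sum by (intro sum.cong) auto
    then show ?thesis
      using True by (simp add: M_def)
  next
    case False
    then have "coeff (coeff G j) k = 0"
      unfolding G coeff_sum by (intro sum.neutral) auto
    then show ?thesis
      using False by (simp add: M_def)
  qed
qed

lemma finite_support_bound: "\<exists>D. \<forall>i j. coeff (coeff (p :: bipoly) j) i \<noteq> 0 \<longrightarrow> i \<le> D"
proof (intro exI allI impI)
  fix i j assume nz: "coeff (coeff p j) i \<noteq> 0"
  then have "j \<le> degree p"
    by (intro le_degree) auto
  then have "degree (coeff p j) \<le> (\<Sum>j\<le>degree p. degree (coeff p j))"
    by (intro member_le_sum) auto
  then show "i \<le> (\<Sum>j\<le>degree p. degree (coeff p j))"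
    using le_degree[OF nz] by simp
qed

lemma chart_subst_eq_0_iff:
  fixes \<delta> :: nat
  shows "rsubst (inverse (rat var_x)) (rat var_x ^ \<delta> * rat var_y) p = 0 \<longleftrightarrow> p = 0"
proof
  assume 0: "rsubst (inverse (rat var_x)) (rat var_x ^ \<delta> * rat var_y) p = 0"
  obtain N where N: "\<And>i j. coeff (coeff p j) i \<noteq> 0 \<Longrightarrow> i \<le> N"
    using finite_support_bound by blast
  then have "coeff (coeff p j) i \<noteq> 0 \<Longrightarrow> i \<le> N + \<delta> * j" for i j
    using trans_le_add1 by blast
  then obtain G where G: "rat G = rat var_x ^ N * rsubst (inverse (rat var_x)) (rat var_x ^ \<delta> * rat var_y) p"
    "\<And>j k. coeff (coeff G j) k = (if k \<le> N + \<delta> * j then coeff (coeff p j) (N + \<delta> * j - k) else 0)"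
    using chart_transform[of p N \<delta>] by blast
  have "G = 0"
    using G(1) by (simp add: 0)
  have "coeff (coeff p j) i = 0" for i j
  proof (rule ccontr)
    assume "coeff (coeff p j) i \<noteq> 0"
    then have "i \<le> N"
      by (rule N)
    then have "coeff (coeff G j) (N + \<delta> * j - i) = coeff (coeff p j) i"
      by (simp add: G(2))
    then show False
      using \<open>coeff (coeff p j) i \<noteq> 0\<close> \<open>G = 0\<close> by simp
  qed
  then show "p = 0"
    by (intro poly_eqI) simp
qed (simp add: rsubst.hom_zero)

text \<open>Only one chart contains the point, and there it is the origin, so no translation
  remains.\<close>

lemma hirz_dicritical_at_infinity_iff:
  "hirz_dicritical \<delta> a b (0, 1, 1, 0) \<longleftrightarrow>
    (\<exists>\<omega>. hirz_foliation \<delta> a b True False \<omega> \<and> dicritical \<omega>)"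
proof -
  have "translate_form (0, 0) \<omega> = \<omega>" for \<omega>
    by (cases \<omega>) (simp add: translate_form_def cst.hom_zero subst_id)
  moreover have "in_hirz_chart i j (0, 1, 1, 0) \<longleftrightarrow> i \<and> \<not> j" for i j
    by (simp add: in_hirz_chart_def)
  moreover have "hirz_coords \<delta> True False (0, 1, 1, 0) = (0, 0)"
    by (simp add: hirz_coords_def)
  ultimately show ?thesis
    unfolding hirz_dicritical_def by metis
qed

lemma hirz_foliation_exists:
  assumes "(a, b) \<noteq> (0, 0)"
  shows "\<exists>\<omega>. hirz_foliation \<delta> a b True False \<omega>"
proof -
  define x y where "x = rat var_x" and "y = rat var_y"
  define \<phi> \<psi> where "\<phi> = inverse x" and "\<psi> = x ^ \<delta> * y"
  obtain R S where RS: "rat_pullback \<phi> \<psi> (b, - a) = (R, S)"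
    by (cases "rat_pullback \<phi> \<psi> (b, - a)")
  have \<phi>: "\<phi> = Fraction_Field.Fract 1 var_x"
    by (simp add: \<phi>_def x_def rat_def)
  \<comment> \<open>The Jacobian matrix is triangular with nonzero diagonal, so a nonzero form
    cannot pull back to zero.\<close>
  have "rdy \<phi> = 0" "rdx \<phi> \<noteq> 0"
    unfolding \<phi> by (simp_all add: rdx_Fract rdy_Fract Zero_fract_def eq_fract)
  moreover have "dy (var_x ^ n) = 0" for n
    by (induction n) (simp_all add: dy_mult)
  then have "rdy \<psi> = x ^ \<delta>"
    by (simp add: \<psi>_def x_def y_def rdy_rules rat.hom_zero rat.hom_one flip: rat.hom_power)
  ultimately have "(R, S) \<noteq> (0, 0)"
    using assms RS
    by (auto simp: rat_pullback_def rsubst.hom_uminus chart_subst_eq_0_iff \<phi>_def \<psi>_def x_def y_def)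
  then show ?thesis
    using coprime_form_exists[of R S] RS
    by (auto simp: hirz_foliation_def hirz_transition_def \<phi>_def \<psi>_def x_def y_def)
qed

lemma chart_integral:
  assumes int: "integral_of f1 f2 (b, - a)" and fol: "hirz_foliation \<delta> a b True False \<omega>"
    and G: "rat G1 = rat var_x ^ N * rsubst (inverse (rat var_x)) (rat var_x ^ \<delta> * rat var_y) f1"
      "rat G2 = rat var_x ^ N * rsubst (inverse (rat var_x)) (rat var_x ^ \<delta> * rat var_y) f2"
  shows "integral_of G1 G2 \<omega>" "\<omega> \<noteq> (0, 0)"
proof -
  obtain R S where RS: "rat_pullback (inverse (rat var_x)) (rat var_x ^ \<delta> * rat var_y) (b, - a) = (R, S)"
    by (cases "rat_pullback (inverse (rat var_x)) (rat var_x ^ \<delta> * rat var_y) (b, - a)")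
  obtain r where "coprime (fst \<omega>) (snd \<omega>)" and r: "rat (fst \<omega>) = r * R" "rat (snd \<omega>) = r * S"
    using fol RS by (auto simp: hirz_foliation_def hirz_transition_def)
  then show "integral_of G1 G2 \<omega>" "\<omega> \<noteq> (0, 0)"
    using rat_integral_of_pullback[OF int RS G r] by auto
qed

lemma chart_independent:
  assumes G: "rat G1 = rat var_x ^ N * rsubst (inverse (rat var_x)) (rat var_x ^ \<delta> * rat var_y) f1"
      "rat G2 = rat var_x ^ N * rsubst (inverse (rat var_x)) (rat var_x ^ \<delta> * rat var_y) f2"
    and "f1 \<noteq> cst c * f2"
  shows "G1 \<noteq> cst c * G2"
proof
  assume "G1 = cst c * G2"
  then have "rat G1 = rcst c * rat G2"
    by (simp add: rcst_def rat.hom_mult)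
  then have "rat var_x ^ N * rsubst (inverse (rat var_x)) (rat var_x ^ \<delta> * rat var_y) (f1 - cst c * f2) = 0"
    unfolding G by (simp only: rsubst.hom_minus rsubst.hom_mult rsubst_gens) (simp add: algebra_simps)
  then have "rsubst (inverse (rat var_x)) (rat var_x ^ \<delta> * rat var_y) (f1 - cst c * f2) = 0"
    by simp
  then show False
    using \<open>f1 \<noteq> cst c * f2\<close> unfolding chart_subst_eq_0_iff by simp
qed

section \<open>Monomials of the pencil and its pole at infinity\<close>

definition pencil_support :: "bipoly \<Rightarrow> bipoly \<Rightarrow> (nat \<times> nat) set" where
  "pencil_support f1 f2 = {(i, j). coeff (coeff f1 j) i \<noteq> 0 \<or> coeff (coeff f2 j) i \<noteq> 0}"

text \<open>
  In the chart \<open>x = 1 / s\<close>, \<open>y = s ^ \<delta> * t\<close> the monomial \<open>x ^ i * y ^ j\<close> becomes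
  \<open>s ^ (\<delta> * j - i) * t ^ j\<close>. Hence \<open>N\<close> is the order of the pole of the pencil along \<open>s = 0\<close>.
\<close>

lemma pole_order_exists:
  fixes \<delta> :: nat
  assumes "coprime f1 f2"
  obtains N where "\<And>i j. (i, j) \<in> pencil_support f1 f2 \<Longrightarrow> i \<le> N + \<delta> * j"
    and "\<exists>j. (N + \<delta> * j, j) \<in> pencil_support f1 f2"
proof -
  define N where "N = (LEAST N. \<forall>(i, j) \<in> pencil_support f1 f2. i \<le> N + \<delta> * j)"
  obtain D1 D2 where D: "\<And>i j. coeff (coeff f1 j) i \<noteq> 0 \<Longrightarrow> i \<le> D1" "\<And>i j. coeff (coeff f2 j) i \<noteq> 0 \<Longrightarrow> i \<le> D2"
    using finite_support_bound by metis
  then have "\<forall>(i, j) \<in> pencil_support f1 f2. i \<le> max D1 D2 + \<delta> * j"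
    by (force simp: pencil_support_def)
  then have bound: "\<forall>(i, j) \<in> pencil_support f1 f2. i \<le> N + \<delta> * j"
    unfolding N_def by (rule LeastI)
  have "\<exists>j. (N + \<delta> * j, j) \<in> pencil_support f1 f2"
  proof (cases N)
    case 0
    \<comment> \<open>For N = 0 minimality among natural numbers says nothing. Instead, coprimality
      excludes the common factor y, so some (i, 0) is in the support, and the bound forces i =
      0.\<close>
    have "coeff f1 0 \<noteq> 0 \<or> coeff f2 0 \<noteq> 0"
    proof (rule ccontr)
      assume "\<not> ?thesis"
      then have "[:0, 1:] dvd f1" "[:0, 1:] dvd f2"
        using poly_eq_0_iff_dvd[of _ "0 :: complex poly"] by (simp_all add: poly_0_coeff_0)
      then have "[:0, 1:] dvd (1 :: bipoly)"
        using assms by (meson coprime_common_divisor)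
      then show False
        using poly_eq_0_iff_dvd[of "1 :: bipoly" 0] by simp
    qed
    then obtain i where i: "(i, 0) \<in> pencil_support f1 f2"
      unfolding pencil_support_def using leading_coeff_0_iff by blast
    then have "i \<le> N + \<delta> * 0"
      using bound by blast
    then show ?thesis
      using i 0 by (intro exI[of _ 0]) simp
  next
    case (Suc n)
    then have "\<not> (\<forall>(i, j) \<in> pencil_support f1 f2. i \<le> n + \<delta> * j)"
      using not_less_Least[of n "\<lambda>N. \<forall>(i, j) \<in> pencil_support f1 f2. i \<le> N + \<delta> * j"]
      by (simp add: N_def)
    then obtain i j where "(i, j) \<in> pencil_support f1 f2" "\<not> i \<le> n + \<delta> * j"
      by blast
    moreover from this bound have "i \<le> N + \<delta> * j"
      by blast
    ultimately show ?thesis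
      using Suc by (metis add_Suc le_antisym not_less_eq_eq)
  qed
  then show ?thesis
    using that bound by blast
qed

text \<open>In the chart the eliminant r(x) becomes a power of s times a local unit, since its
  leading coefficient turns into a constant term. The assumption \<open>attained\<close> keeps s
  from dividing both generators, which supplies the power of t.\<close>

lemma base_point_at_infinity:
  fixes \<delta> :: nat
  defines "s \<equiv> rsubst (inverse (rat var_x)) (rat var_x ^ \<delta> * rat var_y)"
  assumes cop: "coprime f1 f2"
    and attained: "\<exists>j. (N + \<delta> * j, j) \<in> pencil_support f1 f2"
    and G: "rat G1 = rat var_x ^ N * s f1" "rat G2 = rat var_x ^ N * s f2"
      "\<And>j k. coeff (coeff G1 j) k = (if k \<le> N + \<delta> * j then coeff (coeff f1 j) (N + \<delta> * j - k) else 0)"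
      "\<And>j k. coeff (coeff G2 j) k = (if k \<le> N + \<delta> * j then coeff (coeff f2 j) (N + \<delta> * j - k) else 0)"
    and 0: "at_origin G1 = 0" "at_origin G2 = 0" and \<omega>: "integral_of G1 G2 \<omega>" "\<omega> \<noteq> (0, 0)"
  shows "base_point G1 G2 \<omega>"
proof -
  obtain A B r where "r \<noteq> 0" and AB: "A * f1 + B * f2 = [:r:]"
    using elimination_ideal_nonzero[OF cop] by blast
  obtain K1 K2 where K: "\<And>i j. coeff (coeff A j) i \<noteq> 0 \<Longrightarrow> i \<le> K1" "\<And>i j. coeff (coeff B j) i \<noteq> 0 \<Longrightarrow> i \<le> K2"
    using finite_support_bound by metis
  \<comment> \<open>\<open>K\<close> bounds the poles of both cofactors; the summand
    \<open>degree r\<close> makes the exponent \<open>m\<close> below a genuine difference.\<close>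
  define K where "K = K1 + K2 + degree r"
  have "coeff (coeff A j) i \<noteq> 0 \<Longrightarrow> i \<le> K + \<delta> * j" "coeff (coeff B j) i \<noteq> 0 \<Longrightarrow> i \<le> K + \<delta> * j" for i j
    using K(1)[of j i] K(2)[of j i] by (simp_all add: K_def)
  then obtain A' B' where A': "rat A' = rat var_x ^ K * s A" and B': "rat B' = rat var_x ^ K * s B"
    using chart_transform[of A K \<delta>] chart_transform[of B K \<delta>] unfolding s_def by blast
  have "i \<le> (K + N) + \<delta> * j" if "coeff (coeff [:r:] j) i \<noteq> 0" for i j
    using that le_degree[of r i] by (cases j) (simp_all add: K_def)
  then obtain r' where r': "rat r' = rat var_x ^ (K + N) * s [:r:]"
    "\<And>j k. coeff (coeff r' j) k = (if k \<le> K + N + \<delta> * j then coeff (coeff [:r:] j) (K + N + \<delta> * j - k) else 0)"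
    using chart_transform[of "[:r:]" "K + N" \<delta>] unfolding s_def by blast
  have "rat (A' * G1 + B' * G2) = rat var_x ^ (K + N) * s (A * f1 + B * f2)"
    unfolding s_def rsubst.hom_add rsubst.hom_mult
    by (simp add: rat.hom_add rat.hom_mult A' B' G(1,2) power_add algebra_simps s_def)
  then have "rat (A' * G1 + B' * G2) = rat r'"
    unfolding AB r'(1) .
  then have r'_mem: "r' = A' * G1 + B' * G2"
    by (simp only: rat.eq_iff)
  define m where "m = K + N - degree r"
  have deg: "degree r \<le> K + N"
    by (simp add: K_def)
  define U where "U = map_poly (poly_shift m) r'"
  have "r' = var_x ^ m * U"
  proof (rule poly_eqI, rule poly_eqI)
    fix j k
    have "coeff (coeff r' j) k = 0" if "k < m"
    proof (cases j)
      case 0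
      have "degree r < K + N - k"
        using that by (simp add: m_def)
      then show ?thesis
        by (simp add: r'(2) 0 coeff_eq_0)
    qed (simp add: r'(2))
    then show "coeff (coeff r' j) k = coeff (coeff (var_x ^ m * U) j) k"
      unfolding var_x_power by (simp add: U_def coeff_map_poly coeff_monom_mult coeff_poly_shift)
  qed
  moreover have "at_origin U \<noteq> 0"
    using \<open>r \<noteq> 0\<close> deg by (simp add: at_origin_def poly_0_coeff_0 U_def coeff_map_poly coeff_poly_shift r'(2) m_def)
  ultimately have mem_x: "local_mem G1 G2 (var_x ^ m)"
    unfolding local_mem_def using r'_mem by (metis mult.commute)
  have "along_y G1 \<noteq> 0 \<or> along_y G2 \<noteq> 0"
  proof -
    obtain j where "(N + \<delta> * j, j) \<in> pencil_support f1 f2"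
      using attained by blast
    then have "coeff (along_y G1) j \<noteq> 0 \<or> coeff (along_y G2) j \<noteq> 0"
      by (simp add: coeff_along_y G(3,4) pencil_support_def)
    then show ?thesis
      by auto
  qed
  then have "\<exists>L. local_mem G1 G2 (var_y ^ L)"
    using local_mem_other_axis[OF mem_x] local_mem_other_axis[OF local_mem_commute[OF mem_x]] local_mem_commute
    by blast
  then show ?thesis
    unfolding base_point_def using mem_x 0 \<omega> by blast
qed

text \<open>The constant terms of the transformed generators are the coefficients of x^N in f1 and
  f2, so the point is a base point exactly when x^N is missing.\<close>

lemma hirz_dicritical_iff_corner:
  fixes \<delta> :: nat
  assumes int: "integral_of f1 f2 (b, - a)" and ab: "(a, b) \<noteq> (0, 0)" and cop: "coprime f1 f2"
    and nonconst: "\<And>c. f1 \<noteq> cst c * f2" and "f2 \<noteq> 0"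
    and bound: "\<And>i j. (i, j) \<in> pencil_support f1 f2 \<Longrightarrow> i \<le> N + \<delta> * j"
    and attained: "\<exists>j. (N + \<delta> * j, j) \<in> pencil_support f1 f2"
  shows "hirz_dicritical \<delta> a b (0, 1, 1, 0) \<longleftrightarrow> (N, 0) \<notin> pencil_support f1 f2"
proof -
  let ?s = "rsubst (inverse (rat var_x)) (rat var_x ^ \<delta> * rat var_y)"
  have "coeff (coeff f1 j) i \<noteq> 0 \<Longrightarrow> i \<le> N + \<delta> * j" "coeff (coeff f2 j) i \<noteq> 0 \<Longrightarrow> i \<le> N + \<delta> * j" for i j
    using bound by (simp_all add: pencil_support_def)
  then obtain G1 G2 where G: "rat G1 = rat var_x ^ N * ?s f1" "rat G2 = rat var_x ^ N * ?s f2"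
      "\<And>j k. coeff (coeff G1 j) k = (if k \<le> N + \<delta> * j then coeff (coeff f1 j) (N + \<delta> * j - k) else 0)"
      "\<And>j k. coeff (coeff G2 j) k = (if k \<le> N + \<delta> * j then coeff (coeff f2 j) (N + \<delta> * j - k) else 0)"
    using chart_transform[of f1 N \<delta>] chart_transform[of f2 N \<delta>] by blast
  have corner: "at_origin G1 = 0 \<and> at_origin G2 = 0 \<longleftrightarrow> (N, 0) \<notin> pencil_support f1 f2"
    by (simp add: at_origin_def poly_0_coeff_0 G(3,4) pencil_support_def)
  note chart = chart_integral[OF int _ G(1,2)]
  have "G2 \<noteq> 0"
    using G(2) \<open>f2 \<noteq> 0\<close> chart_subst_eq_0_iff[where \<delta> = \<delta> and p = f2] by auto
  show ?thesis
  proof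
    assume "hirz_dicritical \<delta> a b (0, 1, 1, 0)"
    then obtain \<omega> where "hirz_foliation \<delta> a b True False \<omega>" "dicritical \<omega>"
      by (auto simp: hirz_dicritical_at_infinity_iff)
    then show "(N, 0) \<notin> pencil_support f1 f2"
      using regular_pencil_not_dicritical[OF chart _ chart_independent[OF G(1,2) nonconst] \<open>G2 \<noteq> 0\<close>]
      unfolding corner[symmetric] by blast
  next
    assume "(N, 0) \<notin> pencil_support f1 f2"
    then have 0: "at_origin G1 = 0" "at_origin G2 = 0"
      by (simp_all add: corner[symmetric])
    obtain \<omega> where fol: "hirz_foliation \<delta> a b True False \<omega>"
      using hirz_foliation_exists[OF ab] by blast
    have "dicritical \<omega>"
      by (rule base_point_dicritical[OF base_point_at_infinity[OF cop attained G 0 chart[OF fol]]])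
    then show "hirz_dicritical \<delta> a b (0, 1, 1, 0)"
      using fol unfolding hirz_dicritical_at_infinity_iff by blast
  qed
qed

lemma pencil_support_below_delta1:
  assumes int: "integral_of f1 f2 (b, - a)" and ab: "(a, b) \<noteq> (0, 0)" and cop: "coprime f1 f2"
    and nonconst: "\<And>c. f1 \<noteq> cst c * f2" and "f2 \<noteq> 0"
  obtains N where "(N, 0) \<in> pencil_support f1 f2"
    and "\<And>i j. (i, j) \<in> pencil_support f1 f2 \<Longrightarrow> i \<le> N + delta1 a b * j"
proof -
  note corner = hirz_dicritical_iff_corner[OF assms]
  obtain D1 D2 where D: "\<And>i j. coeff (coeff f1 j) i \<noteq> 0 \<Longrightarrow> i \<le> D1" "\<And>i j. coeff (coeff f2 j) i \<noteq> 0 \<Longrightarrow> i \<le> D2"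
    using finite_support_bound by metis
  \<comment> \<open>Once \<delta> exceeds every exponent of x, the pole order can be attained only
    at j = 0. Hence \<open>D\<close> makes the point nondicritical, and the minimum defining
    \<open>delta1\<close> is attained.\<close>
  define D where "D = Suc (max D1 D2)"
  have D: "i < D" if "(i, j) \<in> pencil_support f1 f2" for i j
    using that D by (fastforce simp: pencil_support_def D_def)
  obtain M where M: "\<And>i j. (i, j) \<in> pencil_support f1 f2 \<Longrightarrow> i \<le> M + D * j"
    "\<exists>j. (M + D * j, j) \<in> pencil_support f1 f2"
    using pole_order_exists[OF cop, of D] by blast
  have "(M, 0) \<in> pencil_support f1 f2"
  proof -
    obtain j where j: "(M + D * j, j) \<in> pencil_support f1 f2"
      using M(2) by blast
    then have "j = 0"
      using D[OF j] by (cases j) auto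
    then show ?thesis
      using j by simp
  qed
  then have "\<not> hirz_dicritical D a b (0, 1, 1, 0)"
    using corner[of M D] M by blast
  then have nd: "\<not> hirz_dicritical (delta1 a b) a b (0, 1, 1, 0)"
    unfolding delta1_def by (rule LeastI)
  obtain N where N: "\<And>i j. (i, j) \<in> pencil_support f1 f2 \<Longrightarrow> i \<le> N + delta1 a b * j"
    "\<exists>j. (N + delta1 a b * j, j) \<in> pencil_support f1 f2"
    using pole_order_exists[OF cop, of "delta1 a b"] by blast
  then show ?thesis
    using that corner[of N "delta1 a b"] nd by blast
qed

section \<open>The degree bound\<close>

lemma total_degree_le:
  assumes "\<And>i j. coeff (coeff p j) i \<noteq> 0 \<Longrightarrow> i + j \<le> B"
  shows "total_degree p \<le> B"
proof -
  have "j + degree (coeff p j) \<le> B" if "j \<le> degree p" for j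
  proof (cases "coeff p j = 0")
    case False
    then show ?thesis
      using assms[of j "degree (coeff p j)"] by simp
  next
    \<comment> \<open>A vanishing coefficient still contributes its index j to
      \<open>total_degree\<close>; since j is at most the degree in y, the leading coefficient
      covers it.\<close>
    case True
    have "degree p \<le> B"
    proof (cases "p = 0")
      case False
      then show ?thesis
        using assms[of "degree p" "degree (lead_coeff p)"] by simp
    qed simp
    then show ?thesis
      using True that by simp
  qed
  then show ?thesis
    by (simp add: total_degree_def)
qed

text \<open>Linear independence of \<alpha> and \<beta> over the constants: nothing cancels in the
  generic curve, and its support is the union of those of f1 and f2.\<close>

lemma generic_combination_eq_0_iff:
  "rat var_x * rcst c1 + rat var_y * rcst c2 = 0 \<longleftrightarrow> c1 = 0 \<and> c2 = 0"
proof
  assume "rat var_x * rcst c1 + rat var_y * rcst c2 = 0"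
  then have "rat (var_x * cst c1 + var_y * cst c2) = 0"
    by (simp add: rcst_def rat.hom_add rat.hom_mult)
  then have "dx (var_x * cst c1 + var_y * cst c2) = 0" "dy (var_x * cst c1 + var_y * cst c2) = 0"
    by (simp_all only: rat.hom_0_iff dx_0 dy_0)
  then show "c1 = 0 \<and> c2 = 0"
    by (simp add: dx_add dy_add dx_mult dy_mult)
qed simp

lemma coeff_generic_curve:
  "coeff (coeff (generic_curve f1 f2) j) i =
    rat var_x * rcst (coeff (coeff f1 j) i) + rat var_y * rcst (coeff (coeff f2 j) i)"
  by (simp add: generic_curve_def cst_def coeff_map_poly)

lemma degree_axis_ge:
  shows "(i, 0) \<in> pencil_support f1 f2 \<Longrightarrow> i \<le> degree_x_axis (generic_curve f1 f2)"
    and "(0, j) \<in> pencil_support f1 f2 \<Longrightarrow> j \<le> degree_y_axis (generic_curve f1 f2)"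
  unfolding degree_x_axis_def degree_y_axis_def pencil_support_def
  by (auto intro!: le_degree
      simp: poly_0_coeff_0 coeff_map_poly coeff_generic_curve generic_combination_eq_0_iff)

section \<open>Exchanging the variables\<close>

lemma pencil_support_swap_vars:
  "(i, j) \<in> pencil_support (swap_vars f1) (swap_vars f2) \<longleftrightarrow> (j, i) \<in> pencil_support f1 f2"
  by (simp add: pencil_support_def coeff_swap_vars)

lemma coprime_swap_vars:
  assumes "coprime p q"
  shows "coprime (swap_vars p) (swap_vars q)"
proof (rule coprimeI)
  fix d assume "d dvd swap_vars p" "d dvd swap_vars q"
  then have "swap_vars d dvd p" "swap_vars d dvd q"
    by (metis dvdE dvdI swap_vars.hom_mult swap_vars_swap_vars)+
  then have "swap_vars d dvd 1"
    using assms coprime_common_divisor by blast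
  then show "d dvd 1"
    by (metis dvdE dvdI swap_vars.hom_mult swap_vars.hom_one swap_vars_swap_vars)
qed

lemma integral_of_swap_vars:
  "integral_of f1 f2 (b, - a) \<Longrightarrow> integral_of (swap_vars f1) (swap_vars f2) (swap_vars a, - swap_vars b)"
proof -
  assume "integral_of f1 f2 (b, - a)"
  then have "swap_vars (wedge dx f1 f2 * - a) = swap_vars (wedge dy f1 f2 * b)"
    by (simp add: integral_of_def)
  then have "swap_vars (wedge dy f1 f2) * - swap_vars b = swap_vars (wedge dx f1 f2) * swap_vars a"
    by (simp add: swap_vars.hom_mult swap_vars.hom_uminus) (metis minus_minus)
  moreover have "wedge dx (swap_vars f1) (swap_vars f2) = swap_vars (wedge dy f1 f2)"
    "wedge dy (swap_vars f1) (swap_vars f2) = swap_vars (wedge dx f1 f2)"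
    by (simp_all add: wedge_def dx_swap_vars dy_swap_vars swap_vars.hom_mult swap_vars.hom_minus)
  ultimately show ?thesis
    by (simp add: integral_of_def)
qed

lemma primitive_first_integral_pencil:
  assumes "primitive_first_integral a b f1 f2"
  shows "coprime f1 f2" "f2 \<noteq> 0" "f1 \<noteq> cst c * f2" "integral_of f1 f2 (b, - a)"
proof -
  show "coprime f1 f2" and f2: "f2 \<noteq> 0"
    using assms by (simp_all add: primitive_first_integral_def)
  have int: "rational_first_integral a b (Fraction_Field.Fract f1 f2)"
    using assms by (simp add: primitive_first_integral_def)
  show "f1 \<noteq> cst c * f2"
  proof
    assume "f1 = cst c * f2"
    then have "Fraction_Field.Fract f1 f2 = rcst c"
      using f2 by (simp add: rcst_def rat_def eq_fract)
    then show False
      using int by (auto simp: rational_first_integral_def)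
  qed
  have "Fraction_Field.Fract (a * wedge dx f1 f2) (f2 * f2) + Fraction_Field.Fract (b * wedge dy f1 f2) (f2 * f2) = 0"
    using int f2 by (simp add: rational_first_integral_def rdx_Fract rdy_Fract rat_def wedge_def)
  then have "(a * wedge dx f1 f2 + b * wedge dy f1 f2) * (f2 * f2) = 0"
    using f2 by (simp add: Zero_fract_def eq_fract algebra_simps)
  then have "a * wedge dx f1 f2 + b * wedge dy f1 f2 = 0"
    using f2 by simp
  then show "integral_of f1 f2 (b, - a)"
    by (simp add: integral_of_def algebra_simps) (metis add.commute eq_neg_iff_add_eq_0 minus_equation_iff)
qed

theorem corollary5p3:
  fixes a b f1 f2 :: "complex poly poly"
  assumes "coprime a b"
    and "algebraically_integrable a b"
    and "\<And>c. c \<noteq> 0 \<Longrightarrow> (a, b) \<noteq> (0, cst c)"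
    and "\<And>c. c \<noteq> 0 \<Longrightarrow> (a, b) \<noteq> (cst c, 0)"
    and "primitive_first_integral a b f1 f2"
  shows "(delta1 a b = 0 \<longrightarrow>
            reduced_degree f1 f2
              \<le> (1 + delta1 (swap_vars b) (swap_vars a)) * degree_x_axis (generic_curve f1 f2)
                 + degree_y_axis (generic_curve f1 f2)) \<and>
         (delta1 (swap_vars b) (swap_vars a) = 0 \<longrightarrow>
            reduced_degree f1 f2
              \<le> (1 + delta1 a b) * degree_y_axis (generic_curve f1 f2)
                 + degree_x_axis (generic_curve f1 f2))"
proof -
  note pencil = primitive_first_integral_pencil[OF assms(5)]
  let ?S = "pencil_support f1 f2" and ?\<delta> = "delta1 a b" and ?\<delta>' = "delta1 (swap_vars b) (swap_vars a)"
  let ?dx = "degree_x_axis (generic_curve f1 f2)" and ?dy = "degree_y_axis (generic_curve f1 f2)"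
  have ab: "(a, b) \<noteq> (0, 0)"
    using assms(1) by auto
  obtain N where "(N, 0) \<in> ?S" and N: "\<And>i j. (i, j) \<in> ?S \<Longrightarrow> i \<le> N + ?\<delta> * j"
    using pencil_support_below_delta1[OF pencil(4) ab pencil(1) pencil(3) pencil(2)] by blast
  then have "N \<le> ?dx"
    by (intro degree_axis_ge(1))
  then have x: "i \<le> ?dx + ?\<delta> * j" if "(i, j) \<in> ?S" for i j
    using N[OF that] by simp
  have "(swap_vars b, swap_vars a) \<noteq> (0, 0)" "swap_vars f2 \<noteq> 0"
    "\<And>c. swap_vars f1 \<noteq> cst c * swap_vars f2"
    using ab pencil(2,3) by (metis prod.inject swap_vars.hom_zero swap_vars_swap_vars swap_vars.hom_mult swap_vars_gens(1))+
  then obtain N' where "(N', 0) \<in> pencil_support (swap_vars f1) (swap_vars f2)"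
    and N': "\<And>i j. (i, j) \<in> pencil_support (swap_vars f1) (swap_vars f2) \<Longrightarrow> i \<le> N' + ?\<delta>' * j"
    using pencil_support_below_delta1[OF integral_of_swap_vars[OF pencil(4)] _ coprime_swap_vars[OF pencil(1)]]
    by blast
  then have "N' \<le> ?dy"
    by (intro degree_axis_ge(2)) (simp add: pencil_support_swap_vars)
  then have y: "j \<le> ?dy + ?\<delta>' * i" if "(i, j) \<in> ?S" for i j
    using N'[of j i] that by (simp add: pencil_support_swap_vars)
  have bound: "reduced_degree f1 f2 \<le> B" if "\<And>i j. (i, j) \<in> ?S \<Longrightarrow> i + j \<le> B" for B
    using that by (auto simp: reduced_degree_def pencil_support_def intro!: total_degree_le)
  show ?thesis
  proof (intro conjI impI bound)
    \<comment> \<open>With \<delta>1 = 0 the exponent of x is bounded outright, and this bound is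
      fed into the inequality for the exponent of y.\<close>
    fix i j assume "?\<delta> = 0" "(i, j) \<in> ?S"
    then have "i \<le> ?dx" "j \<le> ?dy + ?\<delta>' * i"
      using x y by fastforce+
    moreover from this have "?\<delta>' * i \<le> ?\<delta>' * ?dx"
      by (intro mult_le_mono2)
    ultimately have "i + j \<le> ?dx + (?dy + ?\<delta>' * ?dx)"
      by linarith
    then show "i + j \<le> (1 + ?\<delta>') * ?dx + ?dy"
      by (simp add: algebra_simps)
  next
    fix i j assume "?\<delta>' = 0" "(i, j) \<in> ?S"
    then have "j \<le> ?dy" "i \<le> ?dx + ?\<delta> * j"
      using x y by fastforce+
    moreover from this have "?\<delta> * j \<le> ?\<delta> * ?dy"
      by (intro mult_le_mono2)
    ultimately have "i + j \<le> ?dy + (?dx + ?\<delta> * ?dy)"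
      by linarith
    then show "i + j \<le> (1 + ?\<delta>) * ?dy + ?dx"
      by (simp add: algebra_simps)
  qed
qed

end
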